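(* Let $A$ be a commutative $\sigma$-C*-algebra and let $E$ be a Hilbert $A$-bimodule. Then every derivation on $L_{A}(E)$ is zero.
   Context: A pro-C*-algebra is a complete Hausdorff complex topological $*$-algebra $A$ whose topology is determined by its continuous C*-seminorms, i.e. a net $\{a_i\}$ converges to $0$ in $A$ if and only if $p(a_i)\to 0$ for every continuous C*-seminorm $p$ on $A$. $S(A)$ denotes the set of all continuous C*-seminorms on $A$. A $\sigma$-C*-algebra is a pro-C*-algebra whose topology is determined by a countable family of C*-seminorms. Algebras are not assumed to be unital. A right pre-Hilbert $A$-module is a right $A$-module $E$, compatible with the complex algebra structure of $A$, equipped with a map $\langle\cdot,\cdot\rangle_A:E\times E\to A$ that is $A$-linear in the second variable and satisfies $\langle x,y\rangle_A=\langle y,x\rangle_A^*$ and $\langle x,x\rangle_A\ge 0$ with equality if and only if $x=0$. It is a right Hilbert $A$-module if it is complete for the topology given by the seminorms $\overline{p}^{A}(\xi)=\sqrt{p(\langle \xi,\xi\rangle_A)}$, $p\in S(A)$. Left Hilbert $A$-modules are defined analogously, with a left $A$-valued inner product ${}_A\langle\cdot,\cdot\rangle$ ($A$-linear in the first variable) and seminorms ${}^{A}\overline{p}(\xi)=\sqrt{p({}_A\langle \xi,\xi\rangle)}$. A Hilbert $A$-bimodule (Hilbert pro-C*-bimodule over $A$) is a left and right Hilbert $A$-module $E$ such that ${}_A\langle x,y\rangle z=x\langle y,z\rangle_A$ for all $x,y,z\in E$, and $\overline{p}^{A}(ax)\le p(a)\,\overline{p}^{A}(x)$ and ${}^{A}\overline{p}(xa)\le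 {}^{A}\overline{p}(x)\,p(a)$ for all $x\in E$, $a\in A$, $p\in S(A)$. $L_A(E)$ is formed with respect to the right Hilbert $A$-module structure. A map $T:E\to E$ is adjointable if there is a map $T^*:E\to E$ with $\langle Tx,y\rangle_A=\langle x,T^*y\rangle_A$ for all $x,y\in E$. $L_A(E)$ denotes the set of all adjointable ($A$-module, bounded with respect to each $\overline{p}^{A}$) maps on $E$; it is a pro-C*-algebra with the topology defined by the C*-seminorms $\tilde p(T)=\sup\{\overline{p}^{A}(Tx): x\in E,\ \overline{p}^{A}(x)\le 1\}$, $p\in S(A)$. A derivation on an algebra $B$ is a linear map $D:B\to B$ with $D(ab)=D(a)b+aD(b)$ for all $a,b\in B$ (no continuity is assumed). *)

theory Defs
  imports "HOL-Analysis.Analysis"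
begin

text \<open>
  The complex scalar multiplications, the involution, the module actions and the inner products
  are explicit parameters. The carriers of the algebra and of the modules are types.
  Algebras are not assumed to be unital.
\<close>

section \<open>Pro-C*-algebras\<close>

locale topological_star_algebra = vector_space scaleA
  for scaleA :: "complex \<Rightarrow> 'a \<Rightarrow>
    'a::{ring, t2_space, uniform_topological_group_add, topological_semigroup_mult}"
    (infixr \<open>*\<^sub>A\<close> 75) +
  fixes star :: "'a \<Rightarrow> 'a"
  assumes scale_mult_left: "(c *\<^sub>A a) * b = c *\<^sub>A (a * b)"
    and scale_mult_right: "a * (c *\<^sub>A b) = c *\<^sub>A (a * b)"
    and star_star: "star (star a) = a"
    and star_add: "star (a + b) = star a + star b"
    and star_scale: "star (c *\<^sub>A a) = cnj c *\<^sub>A star a"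
    and star_mult: "star (a * b) = star b * star a"
    and continuous_scale: "continuous_on UNIV (\<lambda>(c, a). c *\<^sub>A a)"
    and continuous_star: "continuous_on UNIV star"

definition C_star_seminorm ::
    "(complex \<Rightarrow> 'a \<Rightarrow> 'a) \<Rightarrow> ('a \<Rightarrow> 'a) \<Rightarrow> ('a::ring \<Rightarrow> real) \<Rightarrow> bool" where
  "C_star_seminorm scaleA star p \<longleftrightarrow>
     (\<forall>a. 0 \<le> p a) \<and>
     (\<forall>a b. p (a + b) \<le> p a + p b) \<and>
     (\<forall>c a. p (scaleA c a) = cmod c * p a) \<and>
     (\<forall>a b. p (a * b) \<le> p a * p b) \<and>
     (\<forall>a. p (star a * a) = (p a)\<^sup>2)"

definition continuous_C_star_seminorms ::
    "(complex \<Rightarrow> 'a \<Rightarrow> 'a) \<Rightarrow> ('a \<Rightarrow> 'a) \<Rightarrow> ('a::{ring, topological_space} \<Rightarrow> real) set" where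
  "continuous_C_star_seminorms scaleA star =
     {p. C_star_seminorm scaleA star p \<and> continuous_on UNIV p}"

text \<open>
  A net converges to \<open>0\<close> iff every seminorm of the family does along it. Nets are represented by
  filters on the algebra (the image of the section filter of the index set).
\<close>

definition topology_determined_by :: "('a::{zero, topological_space} \<Rightarrow> real) set \<Rightarrow> bool" where
  "topology_determined_by P \<longleftrightarrow>
     (\<forall>F. ((\<lambda>a. a) \<longlongrightarrow> 0) F \<longleftrightarrow> (\<forall>p\<in>P. (p \<longlongrightarrow> 0) F))"

text \<open>
  The uniform structure underlying \<^term>\<open>complete\<close> is the one of the additive group: in the class
  \<^class>\<open>uniform_topological_group_add\<close> it is determined by the topology.
\<close>

locale pro_C_star_algebra = topological_star_algebra +
  assumes complete_algebra: "complete (UNIV :: 'a set)"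
    and topology_determined:
      "topology_determined_by (continuous_C_star_seminorms scaleA star)"

locale sigma_C_star_algebra = pro_C_star_algebra +
  assumes countably_determined:
    "\<exists>P. countable P \<and> (\<forall>p\<in>P. C_star_seminorm scaleA star p) \<and> topology_determined_by P"

definition positive_element :: "('a \<Rightarrow> 'a) \<Rightarrow> 'a::ring \<Rightarrow> bool" where
  "positive_element star a \<longleftrightarrow> (\<exists>b. a = star b * b)"


section \<open>Hilbert modules and bimodules\<close>

definition module_seminorm :: "('e \<Rightarrow> 'e \<Rightarrow> 'a) \<Rightarrow> ('a \<Rightarrow> real) \<Rightarrow> 'e \<Rightarrow> real" where
  "module_seminorm ip p x = sqrt (p (ip x x))"

text \<open>Completeness of a vector space for the topology given by a family of seminorms.\<close>

definition complete_for_seminorms :: "('e::ab_group_add \<Rightarrow> real) set \<Rightarrow> bool" where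
  "complete_for_seminorms Q \<longleftrightarrow>
     (\<forall>F. F \<noteq> bot \<longrightarrow> (\<forall>q\<in>Q. ((\<lambda>(x, y). q (x - y)) \<longlongrightarrow> 0) (F \<times>\<^sub>F F)) \<longrightarrow>
        (\<exists>x. \<forall>q\<in>Q. ((\<lambda>y. q (y - x)) \<longlongrightarrow> 0) F))"

locale right_Hilbert_module =
  pro_C_star_algebra scaleA star + E: vector_space scaleE
  for scaleA :: "complex \<Rightarrow> 'a \<Rightarrow>
      'a::{ring, t2_space, uniform_topological_group_add, topological_semigroup_mult}"
      (infixr \<open>*\<^sub>A\<close> 75)
    and star :: "'a \<Rightarrow> 'a"
    and scaleE :: "complex \<Rightarrow> 'e::ab_group_add \<Rightarrow> 'e" (infixr \<open>*\<^sub>E\<close> 75) +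
  fixes ract :: "'e \<Rightarrow> 'a \<Rightarrow> 'e" (infixl \<open>\<triangleleft>\<close> 75)
    and rinner :: "'e \<Rightarrow> 'e \<Rightarrow> 'a"
  assumes ract_add_left: "(x + y) \<triangleleft> a = x \<triangleleft> a + y \<triangleleft> a"
    and ract_add_right: "x \<triangleleft> (a + b) = x \<triangleleft> a + x \<triangleleft> b"
    and ract_mult: "x \<triangleleft> (a * b) = (x \<triangleleft> a) \<triangleleft> b"
    and ract_scale_left: "(c *\<^sub>E x) \<triangleleft> a = c *\<^sub>E (x \<triangleleft> a)"
    and ract_scale_right: "x \<triangleleft> (c *\<^sub>A a) = c *\<^sub>E (x \<triangleleft> a)"
    and rinner_add: "rinner x (y + z) = rinner x y + rinner x z"
    and rinner_scale: "rinner x (c *\<^sub>E y) = c *\<^sub>A rinner x y"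
    and rinner_ract: "rinner x (y \<triangleleft> a) = rinner x y * a"
    and rinner_star: "rinner x y = star (rinner y x)"
    and rinner_positive: "positive_element star (rinner x x)"
    and rinner_eq_0: "rinner x x = 0 \<longleftrightarrow> x = 0"
    and right_complete:
      "complete_for_seminorms (module_seminorm rinner ` continuous_C_star_seminorms scaleA star)"

locale left_Hilbert_module =
  pro_C_star_algebra scaleA star + E: vector_space scaleE
  for scaleA :: "complex \<Rightarrow> 'a \<Rightarrow>
      'a::{ring, t2_space, uniform_topological_group_add, topological_semigroup_mult}"
      (infixr \<open>*\<^sub>A\<close> 75)
    and star :: "'a \<Rightarrow> 'a"
    and scaleE :: "complex \<Rightarrow> 'e::ab_group_add \<Rightarrow> 'e" (infixr \<open>*\<^sub>E\<close> 75) +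
  fixes lact :: "'a \<Rightarrow> 'e \<Rightarrow> 'e" (infixr \<open>\<triangleright>\<close> 75)
    and linner :: "'e \<Rightarrow> 'e \<Rightarrow> 'a"
  assumes lact_add_left: "(a + b) \<triangleright> x = a \<triangleright> x + b \<triangleright> x"
    and lact_add_right: "a \<triangleright> (x + y) = a \<triangleright> x + a \<triangleright> y"
    and lact_mult: "(a * b) \<triangleright> x = a \<triangleright> (b \<triangleright> x)"
    and lact_scale_left: "(c *\<^sub>A a) \<triangleright> x = c *\<^sub>E (a \<triangleright> x)"
    and lact_scale_right: "a \<triangleright> (c *\<^sub>E x) = c *\<^sub>E (a \<triangleright> x)"
    and linner_add: "linner (x + y) z = linner x z + linner y z"
    and linner_scale: "linner (c *\<^sub>E x) y = c *\<^sub>A linner x y"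
    and linner_lact: "linner (a \<triangleright> x) y = a * linner x y"
    and linner_star: "linner x y = star (linner y x)"
    and linner_positive: "positive_element star (linner x x)"
    and linner_eq_0: "linner x x = 0 \<longleftrightarrow> x = 0"
    and left_complete:
      "complete_for_seminorms (module_seminorm linner ` continuous_C_star_seminorms scaleA star)"

locale Hilbert_bimodule =
  left_Hilbert_module scaleA star scaleE lact linner +
  right_Hilbert_module scaleA star scaleE ract rinner
  for scaleA :: "complex \<Rightarrow> 'a \<Rightarrow>
      'a::{ring, t2_space, uniform_topological_group_add, topological_semigroup_mult}"
      (infixr \<open>*\<^sub>A\<close> 75)
    and star :: "'a \<Rightarrow> 'a"
    and scaleE :: "complex \<Rightarrow> 'e::ab_group_add \<Rightarrow> 'e" (infixr \<open>*\<^sub>E\<close> 75)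
    and lact :: "'a \<Rightarrow> 'e \<Rightarrow> 'e" (infixr \<open>\<triangleright>\<close> 75)
    and linner :: "'e \<Rightarrow> 'e \<Rightarrow> 'a"
    and ract :: "'e \<Rightarrow> 'a \<Rightarrow> 'e" (infixl \<open>\<triangleleft>\<close> 75)
    and rinner :: "'e \<Rightarrow> 'e \<Rightarrow> 'a" +
  assumes inner_compatible: "linner x y \<triangleright> z = x \<triangleleft> rinner y z"
    and lact_bounded: "p \<in> continuous_C_star_seminorms scaleA star \<Longrightarrow>
      module_seminorm rinner p (a \<triangleright> x) \<le> p a * module_seminorm rinner p x"
    and ract_bounded: "p \<in> continuous_C_star_seminorms scaleA star \<Longrightarrow>
      module_seminorm linner p (x \<triangleleft> a) \<le> module_seminorm linner p x * p a"


section \<open>Adjointable maps and derivations\<close>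

definition adjointable_maps ::
    "(complex \<Rightarrow> 'a \<Rightarrow> 'a) \<Rightarrow> ('a \<Rightarrow> 'a) \<Rightarrow> (complex \<Rightarrow> 'e \<Rightarrow> 'e) \<Rightarrow>
     ('e \<Rightarrow> 'a \<Rightarrow> 'e) \<Rightarrow> ('e \<Rightarrow> 'e \<Rightarrow> 'a::{ring, topological_space}) \<Rightarrow>
     ('e::ab_group_add \<Rightarrow> 'e) set" where
  "adjointable_maps scaleA star scaleE ract rinner =
     {T. (\<forall>x y. T (x + y) = T x + T y) \<and>
         (\<forall>c x. T (scaleE c x) = scaleE c (T x)) \<and>
         (\<forall>x a. T (ract x a) = ract (T x) a) \<and>
         (\<forall>p\<in>continuous_C_star_seminorms scaleA star.
            \<exists>C. \<forall>x. module_seminorm rinner p (T x) \<le> C * module_seminorm rinner p x) \<and>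
         (\<exists>T'. \<forall>x y. rinner (T x) y = rinner x (T' y))}"

text \<open>
  Derivation on an algebra given by its carrier \<open>B\<close>, addition, complex scalar multiplication and
  multiplication. Only the values of \<open>D\<close> on \<open>B\<close> matter.
\<close>

definition derivation_on ::
    "'b set \<Rightarrow> ('b \<Rightarrow> 'b \<Rightarrow> 'b) \<Rightarrow> (complex \<Rightarrow> 'b \<Rightarrow> 'b) \<Rightarrow> ('b \<Rightarrow> 'b \<Rightarrow> 'b) \<Rightarrow> ('b \<Rightarrow> 'b) \<Rightarrow> bool" where
  "derivation_on B pls scl tms D \<longleftrightarrow>
     D \<in> B \<rightarrow> B \<and>
     (\<forall>a\<in>B. \<forall>b\<in>B. D (pls a b) = pls (D a) (D b)) \<and>
     (\<forall>c. \<forall>a\<in>B. D (scl c a) = scl c (D a)) \<and>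
     (\<forall>a\<in>B. \<forall>b\<in>B. D (tms a b) = pls (tms (D a) b) (tms a (D b)))"

end

theory Submission
  imports Defs "HOL-Computational_Algebra.Polynomial"
begin

text \<open>
A derivation \<open>D\<close> on the continuous functions on a space vanishes for an algebraic reason: if \<open>f\<close> is real
and \<open>f(s) = 0\<close>, then
\<open>f = w\<^sup>3\<close> with \<open>w(s) = 0\<close>, and \<open>D(f) = 3 w\<^sup>2 D(w)\<close> vanishes at \<open>s\<close>; subtracting constants, which \<open>D\<close> kills, gives
\<open>D(f)(s) = 0\<close> for all \<open>f\<close> and \<open>s\<close>. The proof carries this over to \<open>L(E)\<close>, with functions of a self-adjoint
element in place of functions on a spectrum, so that no characters are needed.

Since the algebra \<open>A\<close> is commutative, the rank one maps \<open>z \<mapsto> x\<langle>y, z\<rangle>\<close> are left multiplications by elements of \<open>A\<close>,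
commute with one another, and force all adjointable maps to commute (\<open>ract_rinner_swap\<close>,
\<open>adjointables_commute\<close>). Left multiplication by any element of \<open>A\<close> is adjointable (\<open>lact_adjoint\<close>). It suffices that \<open>D\<close>
kills left multiplications by self-adjoint elements \<open>a\<close>: it then kills all rank one maps and their products with
any \<open>T\<close>, hence the product of \<open>D(T)\<close> with all rank one maps, and so \<open>D(T) = 0\<close> (\<open>derivation_eq_zero\<close>).

For self-adjoint \<open>a\<close> a continuous functional calculus on the real line is built. Its core is the estimate
\<open>p(P(a)) \<le> sup \<bar>P\<bar>\<close> over an interval for real polynomials \<open>P\<close> (\<open>seminorm_poly_act\<close>), which is obtained from
\<open>p(T\<^sub>k(a)) \<le> 1\<close> for the Chebyshev polynomials when \<open>p(a) \<le> 1\<close>. Weierstrass approximation and completeness then give \<open>g(a)\<close> for all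
continuous \<open>g\<close>, also when \<open>a\<close> is unbounded. With \<open>W = root 3 (a - s)\<close> this yields \<open>D(a) = 3 W\<^sup>2 D(W)\<close> for every real \<open>s\<close>
(\<open>derivation_lact_self_adjoint\<close>).
Finally, an element of \<open>A\<close> that for each \<open>s\<close> is divisible by a function of \<open>a\<close> vanishing at \<open>s\<close> is zero
(\<open>eq_zero_if_locally_divisible\<close>); this is shown by bisection and applied to the left inner products of \<open>D(a) z\<close>.
\<close>

section \<open>Chebyshev polynomials\<close>

text \<open>
The polynomials with \<open>T\<^sub>k (cos x) = cos (k x)\<close> and \<open>U\<^sub>k (cos x) sin x = sin (k x)\<close>. Thus
\<open>chebyshev_U k\<close> has degree \<open>k - 1\<close>: its index is shifted by one against the usual second kind.
The recursion is the addition theorem, which makes the Pythagorean identity below immediate.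
\<close>

fun chebyshev_T :: "nat \<Rightarrow> real poly" and chebyshev_U :: "nat \<Rightarrow> real poly" where
  "chebyshev_T 0 = 1"
| "chebyshev_U 0 = 0"
| "chebyshev_T (Suc k) = [:0, 1:] * chebyshev_T k - [:1, 0, -1:] * chebyshev_U k"
| "chebyshev_U (Suc k) = chebyshev_T k + [:0, 1:] * chebyshev_U k"

lemma chebyshev_pythagoras:
  "(chebyshev_T k)\<^sup>2 + [:1, 0, -1:] * (chebyshev_U k)\<^sup>2 = 1"
proof (induction k)
  case (Suc k)
  have alg: "(t * T - w * U)\<^sup>2 + w * (T + t * U)\<^sup>2 = (t\<^sup>2 + w) * (T\<^sup>2 + w * U\<^sup>2)"
    for t w T U :: "real poly"
    by (simp add: algebra_simps power2_eq_square)
  have "[:0, 1:]\<^sup>2 + [:1, 0, -1:] = (1 :: real poly)"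
    by (simp add: power2_eq_square one_pCons)
  with Suc show ?case by (simp only: chebyshev_T.simps chebyshev_U.simps alg mult_1)
qed simp

lemma poly_chebyshev:
  "poly (chebyshev_T k) (cos x) = cos (real k * x)"
  "poly (chebyshev_U k) (cos x) * sin x = sin (real k * x)"
proof (induction k)
  case (Suc k)
  have s: "1 - cos x * cos x = sin x * sin x"
    using sin_cos_squared_add[of x] by (simp add: power2_eq_square)
  have "poly (chebyshev_T (Suc k)) (cos x)
      = cos x * cos (real k * x) - (1 - cos x * cos x) * poly (chebyshev_U k) (cos x)"
    using Suc by (simp add: algebra_simps)
  also have "\<dots> = cos x * cos (real k * x) - sin x * (poly (chebyshev_U k) (cos x) * sin x)"
    unfolding s by simp
  finally show "poly (chebyshev_T (Suc k)) (cos x) = cos (real (Suc k) * x)"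
    using Suc by (simp add: algebra_simps cos_add)
  have "poly (chebyshev_U (Suc k)) (cos x) * sin x
      = cos (real k * x) * sin x + cos x * (poly (chebyshev_U k) (cos x) * sin x)"
    using Suc by (simp add: algebra_simps)
  then show "poly (chebyshev_U (Suc k)) (cos x) * sin x = sin (real (Suc k) * x)"
    using Suc by (simp add: algebra_simps sin_add)
qed simp_all

lemma chebyshev_T_times_X:
  "[:0, 1:] * chebyshev_T (Suc k) = smult (1/2) (chebyshev_T (Suc (Suc k)) + chebyshev_T k)"
proof -
  define x y where "x = [:0, 1:] * chebyshev_T (Suc k)" and "y = [:1, 0, -1:] * chebyshev_U (Suc k)"
  have "chebyshev_T (Suc (Suc k)) = x - y"
    unfolding x_def y_def by (rule chebyshev_T.simps(2))
  moreover have "chebyshev_T k = x + y"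
  proof -
    have alg: "t * (t * T - w * U) + w * (T + t * U) = (t\<^sup>2 + w) * T"
      for t w T U :: "real poly"
      by (simp add: algebra_simps power2_eq_square)
    have "[:0, 1:]\<^sup>2 + [:1, 0, -1:] = (1 :: real poly)"
      by (simp add: power2_eq_square one_pCons)
    then show ?thesis
      unfolding x_def y_def by (simp only: chebyshev_T.simps chebyshev_U.simps alg mult_1)
  qed
  ultimately have "chebyshev_T (Suc (Suc k)) + chebyshev_T k = 2 * x" by simp
  then show ?thesis unfolding x_def by (simp add: numeral_poly)
qed

declare chebyshev_T.simps(2) [simp del] chebyshev_U.simps(2) [simp del]

text \<open>
The real linear combinations of \<open>T\<^sub>0, \<dots>, T\<^sub>d\<close>; these turn out to be all polynomials of degree at
most \<open>d\<close>.
\<close>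

definition chebyshev_span :: "nat \<Rightarrow> real poly set" where
  "chebyshev_span d = {P. \<exists>c. P = (\<Sum>k\<le>d. smult (c k) (chebyshev_T k))}"

lemma chebyshev_span_add:
  assumes "P \<in> chebyshev_span d" "Q \<in> chebyshev_span d"
  shows "P + Q \<in> chebyshev_span d"
proof -
  from assms obtain c c' where
    "P = (\<Sum>k\<le>d. smult (c k) (chebyshev_T k))" "Q = (\<Sum>k\<le>d. smult (c' k) (chebyshev_T k))"
    unfolding chebyshev_span_def by auto
  then have "P + Q = (\<Sum>k\<le>d. smult (c k + c' k) (chebyshev_T k))"
    by (simp only: smult_add_left sum.distrib)
  then show ?thesis unfolding chebyshev_span_def
    by (intro CollectI exI[of _ "\<lambda>k. c k + c' k"])
qed

lemma chebyshev_span_smult: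
  assumes "P \<in> chebyshev_span d"
  shows "smult r P \<in> chebyshev_span d"
proof -
  from assms obtain c where "P = (\<Sum>k\<le>d. smult (c k) (chebyshev_T k))"
    unfolding chebyshev_span_def by auto
  then have "smult r P = (\<Sum>k\<le>d. smult (r * c k) (chebyshev_T k))"
    by (simp add: poly_eq_iff coeff_sum sum_distrib_left mult.assoc)
  then show ?thesis unfolding chebyshev_span_def
    by (intro CollectI exI[of _ "\<lambda>k. r * c k"])
qed

lemma chebyshev_span_base:
  assumes "k \<le> d"
  shows "chebyshev_T k \<in> chebyshev_span d"
proof -
  have "(\<Sum>j\<le>d. smult (if j = k then 1 else 0) (chebyshev_T j))
      = (\<Sum>j\<le>d. if j = k then chebyshev_T j else 0)"
    by (rule sum.cong) auto
  also have "\<dots> = chebyshev_T k"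
    using assms by (simp add: sum.delta)
  finally show ?thesis unfolding chebyshev_span_def
    by (intro CollectI exI[of _ "\<lambda>j. if j = k then 1 else 0"]) simp
qed

lemma chebyshev_span_sum:
  assumes "finite I" "\<And>i. i \<in> I \<Longrightarrow> f i \<in> chebyshev_span d"
  shows "sum f I \<in> chebyshev_span d"
  using assms
proof (induction I rule: finite_induct)
  case empty
  show ?case using chebyshev_span_smult[OF chebyshev_span_base[of 0 d], of 0] by simp
qed (simp add: chebyshev_span_add)

lemma chebyshev_span_times_X:
  assumes "P \<in> chebyshev_span d"
  shows "[:0, 1:] * P \<in> chebyshev_span (Suc d)"
proof -
  from assms obtain c where P: "P = (\<Sum>k\<le>d. smult (c k) (chebyshev_T k))"
    unfolding chebyshev_span_def by auto
  have "[:0, 1:] * chebyshev_T k \<in> chebyshev_span (Suc d)" if "k \<le> d" for k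
  proof (cases k)
    case 0
    then have "[:0, 1:] * chebyshev_T k = chebyshev_T 1" by (simp add: chebyshev_T.simps(2))
    also have "\<dots> \<in> chebyshev_span (Suc d)" by (rule chebyshev_span_base) simp
    finally show ?thesis .
  next
    case (Suc j)
    show ?thesis unfolding Suc chebyshev_T_times_X using that Suc
      by (intro chebyshev_span_smult chebyshev_span_add chebyshev_span_base) auto
  qed
  moreover have "[:0, 1:] * P = (\<Sum>k\<le>d. smult (c k) ([:0, 1:] * chebyshev_T k))"
    unfolding P by (simp only: sum_distrib_left mult_smult_right)
  ultimately show ?thesis
    by (auto intro!: chebyshev_span_sum chebyshev_span_smult simp del: mult_pCons_left)
qed

lemma in_chebyshev_span:
  assumes "degree P \<le> d"
  shows "P \<in> chebyshev_span d"
  using assms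
proof (induction d arbitrary: P)
  case 0
  then obtain c where "P = [:c:]" by (metis degree_0_id le_zero_eq)
  then have "P = smult c (chebyshev_T 0)" by simp
  then show ?case using chebyshev_span_smult[OF chebyshev_span_base[of 0 0], of c] by simp
next
  case (Suc d)
  obtain c Q where P: "P = pCons c Q" by (cases P)
  have "degree Q \<le> d" using Suc.prems unfolding P by (cases "Q = 0") auto
  then have "[:0, 1:] * Q \<in> chebyshev_span (Suc d)"
    using Suc.IH chebyshev_span_times_X by blast
  moreover have "P = smult c (chebyshev_T 0) + [:0, 1:] * Q"
    unfolding P by simp
  ultimately show ?case
    using chebyshev_span_smult[OF chebyshev_span_base[of 0 "Suc d"], of c]
    by (simp only: chebyshev_span_add zero_le)
qed

lemma has_integral_cos_multiple:
  "((\<lambda>x. cos (real_of_int n * x)) has_integral (if n = 0 then pi else 0)) {0..pi}"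
proof (cases "n = 0")
  case True
  then show ?thesis using has_integral_const_real[of "1::real" 0 pi] by simp
next
  case False
  have "((\<lambda>x. cos (real_of_int n * x)) has_integral
      (sin (real_of_int n * pi) / real_of_int n - sin (real_of_int n * 0) / real_of_int n)) {0..pi}"
    using False
    by (intro fundamental_theorem_of_calculus)
       (auto intro!: derivative_eq_intros simp flip: has_real_derivative_iff_has_vector_derivative)
  then show ?thesis using False by (simp add: sin_npi_int mult.commute)
qed

lemma has_integral_cos_product:
  fixes k l :: nat
  shows "((\<lambda>x. cos (real k * x) * cos (real l * x)) has_integral
     (if k = l then (if k = 0 then pi else pi / 2) else 0)) {0..pi}"
proof -
  have "((\<lambda>x. (cos (real_of_int (int k - int l) * x) + cos (real_of_int (int k + int l) * x)) / 2)
      has_integral ((if int k - int l = 0 then pi else 0) + (if int k + int l = 0 then pi else 0)) / 2)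
      {0..pi}"
    by (intro has_integral_divide has_integral_add has_integral_cos_multiple)
  then show ?thesis
    by (rule has_integral_eq_rhs[OF has_integral_eq[rotated]])
       (auto simp: cos_times_cos algebra_simps)
qed

text \<open>
The factor \<open>2\<close> is the ratio of \<open>\<integral> 1 = \<pi>\<close> to \<open>\<integral> cos\<^sup>2 (k x) = \<pi> / 2\<close> over \<open>[0, \<pi>]\<close>,
where \<open>k \<ge> 1\<close>.
\<close>

lemma chebyshev_coefficient_bound:
  assumes P: "P = (\<Sum>k\<le>d. smult (c k) (chebyshev_T k))"
    and M: "\<And>t. \<bar>t\<bar> \<le> 1 \<Longrightarrow> \<bar>poly P t\<bar> \<le> M"
    and l: "l \<le> d"
  shows "\<bar>c l\<bar> \<le> 2 * M"
proof -
  have "((\<lambda>x. \<Sum>k\<le>d. c k * (cos (real k * x) * cos (real l * x))) has_integral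
      (\<Sum>k\<le>d. c k * (if k = l then (if k = 0 then pi else pi / 2) else 0))) {0..pi}"
    by (intro has_integral_sum has_integral_mult_right has_integral_cos_product) simp
  moreover have "(\<Sum>k\<le>d. c k * (cos (real k * x) * cos (real l * x)))
      = poly P (cos x) * cos (real l * x)" for x
    unfolding P by (simp add: poly_sum poly_chebyshev sum_distrib_right mult.assoc)
  moreover have "(\<Sum>k\<le>d. c k * (if k = l then (if k = 0 then pi else pi / 2) else 0))
      = (\<Sum>k\<le>d. if k = l then c k * (if k = 0 then pi else pi / 2) else 0)"
    by (rule sum.cong) auto
  ultimately have int: "((\<lambda>x. poly P (cos x) * cos (real l * x)) has_integral
      c l * (if l = 0 then pi else pi / 2)) {0..pi}"
    using l by simp
  have "M \<ge> 0" using M[of 0] by (simp add: order.trans[OF abs_ge_zero])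
  have "norm (c l * (if l = 0 then pi else pi / 2)) \<le> M * measure lborel {0..pi}"
  proof (rule has_integral_bound_real[OF \<open>M \<ge> 0\<close> finite.emptyI int])
    fix x :: real
    have "\<bar>poly P (cos x)\<bar> * \<bar>cos (real l * x)\<bar> \<le> M * 1"
      using M[of "cos x"] \<open>M \<ge> 0\<close> by (intro mult_mono) auto
    then show "norm (poly P (cos x) * cos (real l * x)) \<le> M" by (simp add: abs_mult)
  qed
  then have "\<bar>c l\<bar> * (if l = 0 then pi else pi / 2) \<le> M * pi"
    by (simp add: abs_mult split: if_splits)
  moreover have "\<bar>c l\<bar> * (pi / 2) \<le> \<bar>c l\<bar> * (if l = 0 then pi else pi / 2)"
    by (intro mult_left_mono) auto
  ultimately have "\<bar>c l\<bar> * pi \<le> (2 * M) * pi" by linarith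
  then show ?thesis by simp
qed

lemma chebyshev_expansion:
  assumes "degree P \<le> d" and M: "\<And>t. \<bar>t\<bar> \<le> 1 \<Longrightarrow> \<bar>poly P t\<bar> \<le> M"
  shows "\<exists>c. P = (\<Sum>k\<le>d. smult (c k) (chebyshev_T k)) \<and> (\<forall>k\<le>d. \<bar>c k\<bar> \<le> 2 * M)"
  using in_chebyshev_span[OF assms(1)] chebyshev_coefficient_bound[OF _ M]
  unfolding chebyshev_span_def by blast

section \<open>Approximate square roots of \<open>1 - t\<^sup>2\<close>\<close>

text \<open>
Visser's iteration \<open>y\<^sub>0 = 0\<close>, \<open>y\<^sub>n\<^sub>+\<^sub>1 = (t\<^sup>2 + y\<^sub>n\<^sup>2) / 2\<close>, for which \<open>1 - y\<^sub>n\<close> approximates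
\<open>sqrt (1 - t\<^sup>2)\<close>. All coefficients of \<open>y\<^sub>n\<close> and of the increments \<open>y\<^sub>n\<^sub>+\<^sub>1 - y\<^sub>n\<close> are nonnegative, so the
increments can be estimated in any submultiplicative seminorm by their values at \<open>1\<close>.
\<close>

primrec sqrt_defect :: "nat \<Rightarrow> real poly" where
  "sqrt_defect 0 = 0"
| "sqrt_defect (Suc n) = smult (1/2) ([:0, 0, 1:] + (sqrt_defect n)\<^sup>2)"

definition sqrt_error :: "nat \<Rightarrow> real poly" where
  "sqrt_error n = sqrt_defect (Suc n) - sqrt_defect n"

lemma sqrt_approximation:
  "(1 - sqrt_defect n)\<^sup>2 = [:1, 0, -1:] + smult 2 (sqrt_error n)"
proof -
  have "smult 2 (sqrt_defect (Suc n)) = [:0, 0, 1:] + (sqrt_defect n)\<^sup>2" by simp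
  then have "[:1, 0, -1:] + smult 2 (sqrt_error n)
      = [:1, 0, -1:] + [:0, 0, 1:] + (sqrt_defect n)\<^sup>2 - smult 2 (sqrt_defect n)"
    unfolding sqrt_error_def smult_diff_right by simp
  also have "smult 2 (sqrt_defect n) = 2 * sqrt_defect n"
    by (simp add: numeral_poly)
  finally show ?thesis
    by (simp add: power2_eq_square algebra_simps one_pCons)
qed

definition nonneg_coeffs :: "real poly \<Rightarrow> bool" where
  "nonneg_coeffs P \<longleftrightarrow> (\<forall>i. 0 \<le> coeff P i)"

lemma nonneg_coeffs_add: "nonneg_coeffs P \<Longrightarrow> nonneg_coeffs Q \<Longrightarrow> nonneg_coeffs (P + Q)"
  and nonneg_coeffs_mult: "nonneg_coeffs P \<Longrightarrow> nonneg_coeffs Q \<Longrightarrow> nonneg_coeffs (P * Q)"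
  and nonneg_coeffs_smult: "nonneg_coeffs P \<Longrightarrow> 0 \<le> r \<Longrightarrow> nonneg_coeffs (smult r P)"
  and nonneg_coeffs_pCons: "nonneg_coeffs (pCons r P) \<longleftrightarrow> 0 \<le> r \<and> nonneg_coeffs P"
  unfolding nonneg_coeffs_def
  by (auto simp: coeff_mult coeff_pCons split: nat.splits intro!: sum_nonneg)

lemma nonneg_coeffs_0: "nonneg_coeffs 0"
  by (simp add: nonneg_coeffs_def)

lemma nonneg_coeffs_sqrt:
  "nonneg_coeffs (sqrt_defect n)" "nonneg_coeffs (sqrt_error n)"
proof -
  show y: "nonneg_coeffs (sqrt_defect n)" for n
    by (induction n)
      (auto simp: power2_eq_square nonneg_coeffs_pCons nonneg_coeffs_0
        intro!: nonneg_coeffs_add nonneg_coeffs_mult nonneg_coeffs_smult)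
  show "nonneg_coeffs (sqrt_error n)"
  proof (induction n)
    case 0
    then show ?case by (simp add: sqrt_error_def nonneg_coeffs_pCons nonneg_coeffs_0)
  next
    case (Suc n)
    have "sqrt_error (Suc n) = smult (1/2) ([:0, 0, 1:] + (sqrt_defect (Suc n))\<^sup>2)
        - smult (1/2) ([:0, 0, 1:] + (sqrt_defect n)\<^sup>2)"
      unfolding sqrt_error_def by (simp only: sqrt_defect.simps(2))
    also have "\<dots> = smult (1/2) ((sqrt_defect (Suc n))\<^sup>2 - (sqrt_defect n)\<^sup>2)"
      by (simp only: smult_diff_right[symmetric] add_diff_cancel_left)
    also have "(sqrt_defect (Suc n))\<^sup>2 - (sqrt_defect n)\<^sup>2
        = (sqrt_defect (Suc n) + sqrt_defect n) * sqrt_error n"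
      unfolding sqrt_error_def
      by (simp add: power2_eq_square algebra_simps del: sqrt_defect.simps)
    finally have "sqrt_error (Suc n)
        = smult (1/2) ((sqrt_defect (Suc n) + sqrt_defect n) * sqrt_error n)" .
    then show ?case using Suc y
      by (auto intro!: nonneg_coeffs_smult nonneg_coeffs_mult nonneg_coeffs_add
        simp del: sqrt_defect.simps)
  qed
qed

lemma sqrt_error_at_1_tendsto: "(\<lambda>n. poly (sqrt_error n) 1) \<longlonglongrightarrow> 0"
proof -
  let ?y = "\<lambda>n. poly (sqrt_defect n) 1"
  have nn: "nonneg_coeffs P \<Longrightarrow> 0 \<le> poly P 1" for P
    by (simp add: poly_altdef nonneg_coeffs_def sum_nonneg)
  have rec: "?y (Suc n) = (1 + (?y n)\<^sup>2) / 2" for n by (simp add: power2_eq_square)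
  have "?y n \<le> 1" for n
  proof (induction n)
    case (Suc n)
    have "(?y n)\<^sup>2 \<le> 1"
      using Suc nn[OF nonneg_coeffs_sqrt(1)[of n]] by (simp add: abs_square_le_1)
    then show ?case unfolding rec by simp
  qed simp
  moreover have "?y n \<le> ?y (Suc n)" for n
    using nn[OF nonneg_coeffs_sqrt(2)[of n]] unfolding sqrt_error_def by simp
  ultimately obtain l where "?y \<longlonglongrightarrow> l"
    using incseq_convergent[of ?y 1] by (metis incseq_SucI)
  from tendsto_diff[OF LIMSEQ_Suc[OF this] this] show ?thesis
    unfolding sqrt_error_def by simp
qed

section \<open>Polynomial approximation on the line\<close>

lemma real_polynomial_approximation:
  fixes g :: "real \<Rightarrow> real"
  assumes "continuous_on UNIV g" "0 < e"
  shows "\<exists>P. \<forall>t. \<bar>t\<bar> \<le> R \<longrightarrow> \<bar>g t - poly P t\<bar> \<le> e"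
proof -
  obtain q where q: "real_polynomial_function q" "\<And>t. t \<in> {-R..R} \<Longrightarrow> \<bar>g t - q t\<bar> < e"
    using Stone_Weierstrass_real_polynomial_function[of "{-R..R}" g e] assms
    by (metis compact_Icc continuous_on_subset subset_UNIV)
  obtain a n where an: "q = (\<lambda>x. \<Sum>i\<le>n. a i * x ^ i)"
    using q(1) real_polynomial_function_iff_sum by blast
  have "poly (\<Sum>i\<le>n. monom (a i) i) t = q t" for t
    by (simp add: an poly_sum poly_monom)
  then show ?thesis
    using q(2) by (intro exI[of _ "\<Sum>i\<le>n. monom (a i) i"]) (simp add: less_imp_le abs_le_iff[of _ R])
qed

section \<open>C*-seminorms on commutative pro-C*-algebras\<close>

locale commutative_pro_C_star_algebra = pro_C_star_algebra +
  assumes mult_commute: "(a :: 'a) * b = b * a"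
begin

lemma star_zero: "star 0 = 0"
  using star_add[of 0 0] by simp

lemma star_minus: "star (- a) = - star a"
  using star_add[of a "- a"] star_zero by (metis add.right_inverse add_eq_0_iff)

lemma star_diff: "star (a - b) = star a - star b"
  using star_add[of a "- b"] star_minus by simp

context
  fixes p :: "'a \<Rightarrow> real"
  assumes p: "C_star_seminorm scaleA star p"
begin

lemma seminorm_nonneg: "0 \<le> p a"
  and seminorm_add: "p (a + b) \<le> p a + p b"
  and seminorm_scale: "p (c *\<^sub>A a) = cmod c * p a"
  and seminorm_mult: "p (a * b) \<le> p a * p b"
  and seminorm_star_mult: "p (star a * a) = (p a)\<^sup>2"
  using p unfolding C_star_seminorm_def by blast+

lemma seminorm_zero: "p 0 = 0"
  using seminorm_scale[of 0 0] by simp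

lemma seminorm_minus: "p (- a) = p a"
  using seminorm_scale[of "-1" a] by simp

lemma seminorm_diff: "p (a - b) \<le> p a + p b"
  using seminorm_add[of a "- b"] seminorm_minus by simp

lemma seminorm_star: "p (star a) = p a"
proof -
  have "p a \<le> p (star a)" for a
  proof (cases "p a = 0")
    case False
    have "p a * p a \<le> p (star a) * p a"
      using seminorm_star_mult[of a] seminorm_mult[of "star a" a] by (simp add: power2_eq_square)
    then show ?thesis using False seminorm_nonneg[of a] by simp
  qed (simp add: seminorm_nonneg)
  from this[of a] this[of "star a"] show ?thesis by (simp add: star_star)
qed

lemma seminorm_square: "p (a * a) = (p a)\<^sup>2"
proof -
  have "(p (a * a))\<^sup>2 = p (star (a * a) * (a * a))" by (simp add: seminorm_star_mult)
  also have "star (a * a) * (a * a) = (star a * a) * (star a * a)"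
    by (metis star_mult mult.assoc mult_commute)
  also have "\<dots> = star (star a * a) * (star a * a)"
    by (simp add: star_mult star_star)
  also have "p \<dots> = ((p a)\<^sup>2)\<^sup>2" by (simp only: seminorm_star_mult)
  finally show ?thesis
    using power2_eq_iff_nonneg[of "p (a * a)" "(p a)\<^sup>2"] seminorm_nonneg by simp
qed

end

section \<open>The action of real polynomials\<close>

text \<open>
The element \<open>P(a) h\<close>, evaluated by Horner's scheme. Letting polynomials act on elements, instead of
forming \<open>P(a)\<close>, gives a meaning to constant terms although the algebra need not have a unit.
\<close>

definition poly_act :: "'a \<Rightarrow> real poly \<Rightarrow> 'a \<Rightarrow> 'a" where
  "poly_act a P h = fold_coeffs (\<lambda>c x. of_real c *\<^sub>A h + a * x) P 0"

lemma poly_act_0 [simp]: "poly_act a 0 h = 0"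
  by (simp add: poly_act_def)

lemma poly_act_pCons [simp]: "poly_act a (pCons c P) h = of_real c *\<^sub>A h + a * poly_act a P h"
  by (cases "c = 0 \<and> P = 0") (auto simp: poly_act_def)

lemma poly_act_1 [simp]: "poly_act a 1 h = h"
  by (simp add: one_pCons)

lemma poly_act_add: "poly_act a (P + Q) h = poly_act a P h + poly_act a Q h"
  by (induction P Q rule: poly_induct2) (simp_all add: scale_left_distrib algebra_simps)

lemma poly_act_smult: "poly_act a (smult r P) h = of_real r *\<^sub>A poly_act a P h"
  by (induction P) (simp_all add: scale_right_distrib scale_mult_right)

lemma poly_act_diff: "poly_act a (P - Q) h = poly_act a P h - poly_act a Q h"
  using poly_act_add[of a P "smult (-1) Q" h] by (simp only: poly_act_smult) simp

lemma poly_act_sum: "poly_act a (sum f I) h = (\<Sum>i\<in>I. poly_act a (f i) h)"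
  by (induction I rule: infinite_finite_induct) (simp_all add: poly_act_add)

lemma poly_act_mult: "poly_act a (P * Q) h = poly_act a P (poly_act a Q h)"
  by (induction P) (simp_all add: poly_act_add poly_act_smult)

lemma poly_act_add_right: "poly_act a P (x + y) = poly_act a P x + poly_act a P y"
  by (induction P) (simp_all add: scale_right_distrib algebra_simps)

lemma poly_act_scale_right: "poly_act a P (c *\<^sub>A x) = c *\<^sub>A poly_act a P x"
  by (induction P) (simp_all add: scale_right_distrib scale_mult_right scale_left_commute)

lemma poly_act_diff_right: "poly_act a P (x - y) = poly_act a P x - poly_act a P y"
  using poly_act_add_right[of a P x "(-1) *\<^sub>A y"] by (simp only: poly_act_scale_right) simp

lemma poly_act_mult_right: "poly_act a P (x * y) = poly_act a P x * y"
  by (induction P) (simp_all add: scale_mult_left algebra_simps)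

lemma poly_act_star: "star a = a \<Longrightarrow> star (poly_act a P h) = poly_act a P (star h)"
  by (induction P) (simp_all add: star_zero star_add star_scale star_mult mult_commute[of a])

lemma poly_act_pcompose:
  "poly_act a (pcompose P [:0, r:]) h = poly_act (of_real r *\<^sub>A a) P h"
  by (induction P) (simp_all add: pcompose_pCons poly_act_add poly_act_smult poly_act_mult
      scale_mult_left scale_mult_right)

section \<open>The norm of a polynomial in a self-adjoint element\<close>

context
  fixes p :: "'a \<Rightarrow> real" and a :: 'a
  assumes p: "C_star_seminorm scaleA star p" and sa: "star a = a"
begin

text \<open>
The C*-identity for \<open>X(a) \<plusminus> \<i> Y(a)\<close>, whose product with its adjoint is \<open>X(a)\<^sup>2 + Y(a)\<^sup>2\<close>; the element
\<open>X(a)\<close> is the mean of the two. For \<open>Y = 0\<close> this is the C*-identity for the operator \<open>X(a)\<close>.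
\<close>

lemma seminorm_poly_act_sum_of_squares:
  "(p (poly_act a X h))\<^sup>2 \<le> p h * p (poly_act a (X\<^sup>2 + Y\<^sup>2) h)"
proof -
  define x y where "x = poly_act a X h" and "y = poly_act a Y h"
  define K where "K = p h * p (poly_act a (X\<^sup>2 + Y\<^sup>2) h)"
  have prod: "star (poly_act a V h) * poly_act a W h = star h * poly_act a (V * W) h" for V W
    by (metis mult.commute mult_commute poly_act_mult poly_act_mult_right poly_act_star sa)
  have bound: "(p (x + e *\<^sub>A y))\<^sup>2 \<le> K" if e: "cnj e * e = 1" "cnj e = - e" for e
  proof -
    have "star (x + e *\<^sub>A y) * (x + e *\<^sub>A y)
        = star x * x + e *\<^sub>A (star x * y) + cnj e *\<^sub>A (star y * x) + (cnj e * e) *\<^sub>A (star y * y)"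
      by (simp add: star_add star_scale algebra_simps scale_mult_left scale_mult_right)
    also have "star x * y = star y * x"
      unfolding x_def y_def prod by (simp add: mult.commute)
    also have "star x * x + e *\<^sub>A (star y * x) + cnj e *\<^sub>A (star y * x) + (cnj e * e) *\<^sub>A (star y * y)
        = star x * x + star y * y"
      unfolding e(1) by (simp add: e(2))
    also have "\<dots> = star h * poly_act a (X\<^sup>2 + Y\<^sup>2) h"
      unfolding x_def y_def prod
      by (simp add: poly_act_add power2_eq_square distrib_left)
    finally have "(p (x + e *\<^sub>A y))\<^sup>2 = p (star h * poly_act a (X\<^sup>2 + Y\<^sup>2) h)"
      by (metis seminorm_star_mult[OF p])
    also have "\<dots> \<le> K"
      unfolding K_def using seminorm_mult[OF p] seminorm_star[OF p] by metis
    finally show ?thesis .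
  qed
  define u v where "u = x + \<i> *\<^sub>A y" and "v = x + (- \<i>) *\<^sub>A y"
  have "x = (1/2) *\<^sub>A (u + v)"
    using scale_left_distrib[of "1/2" "1/2" x]
    unfolding u_def v_def by (simp add: scale_right_distrib)
  then have "p x = (1/2) * p (u + v)"
    using seminorm_scale[OF p, of "1/2" "u + v"] by simp
  moreover have "p u \<le> sqrt K" "p v \<le> sqrt K"
    unfolding u_def v_def by (rule real_le_rsqrt[OF bound]; simp)+
  ultimately have "p x \<le> sqrt K" using seminorm_add[OF p, of u v] by linarith
  then have "(p x)\<^sup>2 \<le> (sqrt K)\<^sup>2"
    using seminorm_nonneg[OF p] by (intro power_mono)
  moreover have "0 \<le> K" unfolding K_def using seminorm_nonneg[OF p] by simp
  ultimately show ?thesis unfolding x_def K_def by simp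
qed

lemma seminorm_poly_act_nonneg_coeffs:
  assumes "nonneg_coeffs P" "p a \<le> 1"
  shows "p (poly_act a P h) \<le> poly P 1 * p h"
  using assms(1)
proof (induction P)
  case (pCons c P)
  then have c: "0 \<le> c" "nonneg_coeffs P" by (simp_all add: nonneg_coeffs_pCons)
  have "p (poly_act a (pCons c P) h) \<le> c * p h + p a * p (poly_act a P h)"
    using seminorm_add[OF p, of "of_real c *\<^sub>A h" "a * poly_act a P h"]
      seminorm_mult[OF p, of a "poly_act a P h"] c(1)
    by (simp add: seminorm_scale[OF p])
  also have "p a * p (poly_act a P h) \<le> 1 * (poly P 1 * p h)"
    using pCons.IH[OF c(2)] assms(2) seminorm_nonneg[OF p] by (intro mult_mono) auto
  finally show ?case by (simp add: algebra_simps)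
qed (simp add: seminorm_zero[OF p])

text \<open>
As \<open>T\<^sub>k\<^sup>2 + (1 - t\<^sup>2) U\<^sub>k\<^sup>2 = 1\<close> and \<open>1 - t\<^sup>2\<close> is approximately the square of a polynomial, the sum of squares
estimate bounds \<open>T\<^sub>k(a)\<close> by \<open>1\<close>. This is where self-adjointness of \<open>a\<close> restricts its spectrum to the real line.
\<close>

lemma seminorm_chebyshev:
  assumes a1: "p a \<le> 1"
  shows "p (poly_act a (chebyshev_T k) h) \<le> p h"
proof -
  let ?T = "chebyshev_T k" and ?U = "chebyshev_U k"
  let ?\<delta> = "\<lambda>n. poly (sqrt_error n) 1"
  have step: "(p (poly_act a ?T h))\<^sup>2 \<le> p h * (p h + 2 * (?\<delta> n * p (poly_act a (?U\<^sup>2) h)))" for n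
  proof -
    have "?T\<^sup>2 + ((1 - sqrt_defect n) * ?U)\<^sup>2
        = (?T\<^sup>2 + [:1, 0, -1:] * ?U\<^sup>2) + smult 2 (sqrt_error n * ?U\<^sup>2)"
      unfolding power_mult_distrib sqrt_approximation
      by (simp only: distrib_right mult_smult_left add.assoc)
    then have "(p (poly_act a ?T h))\<^sup>2 \<le> p h * p (poly_act a (1 + smult 2 (sqrt_error n * ?U\<^sup>2)) h)"
      using seminorm_poly_act_sum_of_squares[of ?T h "(1 - sqrt_defect n) * ?U"]
      by (simp only: chebyshev_pythagoras)
    also have "p (poly_act a (1 + smult 2 (sqrt_error n * ?U\<^sup>2)) h)
        \<le> p h + 2 * p (poly_act a (sqrt_error n) (poly_act a (?U\<^sup>2) h))"
      unfolding poly_act_add poly_act_1 poly_act_smult poly_act_mult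
      using seminorm_add[OF p] seminorm_scale[OF p] by (metis norm_of_real abs_numeral)
    also have "p (poly_act a (sqrt_error n) (poly_act a (?U\<^sup>2) h)) \<le> ?\<delta> n * p (poly_act a (?U\<^sup>2) h)"
      by (rule seminorm_poly_act_nonneg_coeffs[OF nonneg_coeffs_sqrt(2) a1])
    finally show ?thesis
      by (simp add: mult_left_mono seminorm_nonneg[OF p])
  qed
  have "(\<lambda>n. p h * (p h + 2 * (?\<delta> n * p (poly_act a (?U\<^sup>2) h))))
      \<longlonglongrightarrow> p h * (p h + 2 * (0 * p (poly_act a (?U\<^sup>2) h)))"
    by (intro tendsto_intros sqrt_error_at_1_tendsto)
  then have "(p (poly_act a ?T h))\<^sup>2 \<le> p h * (p h + 2 * (0 * p (poly_act a (?U\<^sup>2) h)))"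
    using step by (intro LIMSEQ_le_const) auto
  then show ?thesis
    by (simp add: power2_eq_square[symmetric] power2_le_iff_abs_le seminorm_nonneg[OF p])
qed

lemma seminorm_poly_act_power:
  assumes "0 \<le> K" "\<And>h. p (poly_act a (P ^ (2 ^ m)) h) \<le> K ^ (2 ^ m) * p h"
  shows "p (poly_act a P h) \<le> K * p h"
  using assms
proof (induction m arbitrary: P K h)
  case (Suc m)
  have "p (poly_act a (P\<^sup>2) h) \<le> K\<^sup>2 * p h" for h
    using Suc.IH[of "K\<^sup>2" "P\<^sup>2" h] Suc.prems by (simp add: power_mult)
  then have "p h * p (poly_act a (P\<^sup>2) h) \<le> p h * (K\<^sup>2 * p h)"
    by (intro mult_left_mono seminorm_nonneg[OF p])
  then have "(p (poly_act a P h))\<^sup>2 \<le> (K * p h)\<^sup>2"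
    using seminorm_poly_act_sum_of_squares[of P h 0] by (simp add: power2_eq_square algebra_simps)
  then show ?case
    using Suc.prems(1) seminorm_nonneg[OF p] by (simp add: power2_le_iff_abs_le)
qed simp

text \<open>
Expanding in Chebyshev polynomials gives \<open>p(P(a)) \<le> 2 (deg P + 1) sup \<bar>P\<bar>\<close>. Applied to the powers \<open>P\<^sup>N\<close>, where
the factor grows only linearly in \<open>N\<close>, the C*-identity removes the factor.
\<close>

lemma seminorm_poly_act_unit_interval:
  assumes a1: "p a \<le> 1" and M: "\<And>t. \<bar>t\<bar> \<le> 1 \<Longrightarrow> \<bar>poly P t\<bar> \<le> M"
  shows "p (poly_act a P h) \<le> M * p h"
proof -
  have M0: "0 \<le> M" using M[of 0] by (simp add: order.trans[OF abs_ge_zero])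
  define d where "d = degree P"
  have crude: "p (poly_act a (P ^ N) h) \<le> 2 * (real (d * N) + 1) * M ^ N * p h" for N h
  proof -
    have "degree (P ^ N) \<le> d * N" unfolding d_def by (rule degree_power_le)
    moreover have "\<bar>poly (P ^ N) t\<bar> \<le> M ^ N" if "\<bar>t\<bar> \<le> 1" for t
      using M[OF that] by (simp add: power_abs power_mono)
    ultimately obtain c where c: "P ^ N = (\<Sum>k\<le>d * N. smult (c k) (chebyshev_T k))"
      "\<And>k. k \<le> d * N \<Longrightarrow> \<bar>c k\<bar> \<le> 2 * M ^ N"
      using chebyshev_expansion[of "P ^ N" "d * N" "M ^ N"] by blast
    have "p (sum f I) \<le> (\<Sum>i\<in>I. p (f i))" for f and I :: "nat set"
      by (induction I rule: infinite_finite_induct)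
        (auto simp: seminorm_zero[OF p] intro: order.trans[OF seminorm_add[OF p]])
    then have "p (poly_act a (P ^ N) h) \<le> (\<Sum>k\<le>d * N. p (poly_act a (smult (c k) (chebyshev_T k)) h))"
      unfolding c(1) poly_act_sum .
    also have "\<dots> \<le> (\<Sum>k\<le>d * N. 2 * M ^ N * p h)"
    proof (rule sum_mono)
      fix k assume "k \<in> {..d * N}"
      then have "\<bar>c k\<bar> * p (poly_act a (chebyshev_T k) h) \<le> 2 * M ^ N * p h"
        using c(2) seminorm_chebyshev[OF a1] seminorm_nonneg[OF p] M0 by (intro mult_mono) auto
      then show "p (poly_act a (smult (c k) (chebyshev_T k)) h) \<le> 2 * M ^ N * p h"
        by (simp add: poly_act_smult seminorm_scale[OF p])
    qed
    finally show ?thesis by (simp add: algebra_simps)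
  qed
  \<comment> \<open>For \<open>K > M\<close> the geometric decay of \<open>(M / K)\<^sup>N\<close> beats the linear factor, and \<open>N\<close> may be taken to be
    a power of two.\<close>
  have K: "p (poly_act a P h) \<le> K * p h" if "M < K" for K
  proof -
    define q where "q = M / K"
    have "0 < K" "0 \<le> q" "q < 1" using that M0 unfolding q_def by auto
    then have "(\<lambda>n. 2 * real d * (real n * q ^ n) + 2 * q ^ n) \<longlonglongrightarrow> 2 * real d * 0 + 2 * 0"
      by (intro tendsto_intros powser_times_n_limit_0 LIMSEQ_realpow_zero) auto
    then have "eventually (\<lambda>n. 2 * real d * (real n * q ^ n) + 2 * q ^ n < 1) sequentially"
      by (rule order_tendstoD) simp
    then obtain n0 where n0: "\<And>n. n \<ge> n0 \<Longrightarrow> 2 * real d * (real n * q ^ n) + 2 * q ^ n < 1"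
      unfolding eventually_sequentially by blast
    define N :: nat where "N = 2 ^ n0"
    have "2 * real d * (real N * q ^ N) + 2 * q ^ N < 1"
      by (rule n0) (simp add: N_def less_imp_le)
    then have "2 * (real (d * N) + 1) * q ^ N * K ^ N \<le> 1 * K ^ N"
      using \<open>0 < K\<close> by (intro mult_right_mono) (auto simp: algebra_simps)
    then have "2 * (real (d * N) + 1) * M ^ N \<le> K ^ N"
      using \<open>0 < K\<close> unfolding q_def by (simp add: power_divide)
    then have "p (poly_act a (P ^ N) h) \<le> K ^ N * p h" for h
      using crude[of N h] mult_right_mono[OF _ seminorm_nonneg[OF p, of h]] order.trans by blast
    then show ?thesis
      using \<open>0 < K\<close> unfolding N_def by (intro seminorm_poly_act_power[of K P n0]) auto
  qed
  have "((\<lambda>K. K * p h) \<longlongrightarrow> M * p h) (at_right M)"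
    by (intro tendsto_intros)
  then show ?thesis
    using eventually_at_right_less[of M]
    by (rule tendsto_lowerbound[OF _ eventually_mono]) (auto intro: K)
qed

end

lemma seminorm_poly_act:
  assumes p: "C_star_seminorm scaleA star p" and sa: "star a = a"
    and r: "p a \<le> r" "0 < r" and M: "\<And>t. \<bar>t\<bar> \<le> r \<Longrightarrow> \<bar>poly P t\<bar> \<le> M"
  shows "p (poly_act a P h) \<le> M * p h"
proof -
  define b where "b = of_real (1/r) *\<^sub>A a"
  have a: "a = of_real r *\<^sub>A b" using r unfolding b_def by (simp flip: of_real_mult)
  have "star b = b" unfolding b_def star_scale sa by simp
  moreover have "p b \<le> 1" unfolding b_def seminorm_scale[OF p] using r by (simp add: norm_divide)
  moreover have "\<bar>poly (pcompose P [:0, r:]) t\<bar> \<le> M" if "\<bar>t\<bar> \<le> 1" for t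
    using M[of "r * t"] that r by (simp add: poly_pcompose abs_mult mult.commute)
  ultimately show ?thesis
    unfolding a poly_act_pcompose[symmetric] by (rule seminorm_poly_act_unit_interval[OF p])
qed

section \<open>Continuous functional calculus\<close>

abbreviation seminorms :: "('a \<Rightarrow> real) set" where
  "seminorms \<equiv> continuous_C_star_seminorms scaleA star"

lemma seminormsD: "p \<in> seminorms \<Longrightarrow> C_star_seminorm scaleA star p"
  by (simp add: continuous_C_star_seminorms_def)

text \<open>
The seminorms separate points because the topology that they determine is Hausdorff.
\<close>

lemma eq_zero_if_seminorms_zero:
  assumes "\<And>p. p \<in> seminorms \<Longrightarrow> p x = 0"
  shows "x = 0"
proof -
  have "(p \<longlongrightarrow> 0) (principal {x})" if "p \<in> seminorms" for p
    using assms[OF that] by (auto intro!: tendsto_eventually simp: eventually_principal)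
  then have "((\<lambda>a. a) \<longlongrightarrow> 0) (principal {x})"
    using topology_determined unfolding topology_determined_by_def by blast
  moreover have "((\<lambda>a. a) \<longlongrightarrow> x) (principal {x})"
    by (auto intro!: tendsto_eventually simp: eventually_principal)
  ultimately show ?thesis
    by (metis tendsto_unique principal_eq_bot_iff insert_not_empty)
qed

lemma seminorms_Cauchy_converges:
  assumes "\<And>p e. p \<in> seminorms \<Longrightarrow> 0 < e \<Longrightarrow>
    \<exists>N. \<forall>m\<ge>N. \<forall>n\<ge>N. p (X m - X n) < e"
  shows "\<exists>x. \<forall>p\<in>seminorms. (\<lambda>n. p (X n - x)) \<longlonglongrightarrow> 0"
proof -
  define F where "F = filtermap X sequentially"
  define G where "G = filtermap (\<lambda>(x, y). y - x) (F \<times>\<^sub>F F)"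
  have "(p \<longlongrightarrow> 0) G" if "p \<in> seminorms" for p
  proof (rule tendstoI)
    fix e :: real assume "0 < e"
    from assms[OF that this] obtain N where N: "\<And>m n. m \<ge> N \<Longrightarrow> n \<ge> N \<Longrightarrow> p (X m - X n) < e"
      by blast
    have "eventually (\<lambda>x. \<exists>n\<ge>N. x = X n) F"
      unfolding F_def eventually_filtermap eventually_sequentially by blast
    then have "eventually (\<lambda>(x, y). p (y - x) < e) (F \<times>\<^sub>F F)"
      unfolding eventually_prod_same using N by fastforce
    then show "eventually (\<lambda>x. dist (p x) 0 < e) G"
      unfolding G_def eventually_filtermap
      by (simp add: case_prod_unfold seminorm_nonneg[OF seminormsD[OF that]])
  qed
  then have "((\<lambda>a. a) \<longlongrightarrow> 0) G"
    using topology_determined unfolding topology_determined_by_def by blast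
  then have "cauchy_filter F"
    unfolding cauchy_filter_def cauchy_seq_finset_iff_vanishing G_def filterlim_def
    by (simp add: filtermap_le_iff_le_filtercomap)
  moreover have "F \<noteq> bot" unfolding F_def by (simp add: filtermap_bot_iff)
  ultimately obtain x where "F \<le> nhds x"
    using cauchy_filter_complete_converges[OF _ complete_algebra] by auto
  then have "X \<longlonglongrightarrow> x" unfolding F_def filterlim_def .
  from tendsto_diff[OF this tendsto_const[of x]] have "(\<lambda>n. X n - x) \<longlonglongrightarrow> 0" by simp
  then have "((\<lambda>a. a) \<longlongrightarrow> 0) (filtermap (\<lambda>n. X n - x) sequentially)"
    by (simp add: filterlim_def filtermap_filtermap)
  then have "\<forall>p\<in>seminorms. (p \<longlongrightarrow> 0) (filtermap (\<lambda>n. X n - x) sequentially)"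
    using topology_determined unfolding topology_determined_by_def by blast
  then show ?thesis by (auto simp: filterlim_def filtermap_filtermap)
qed

text \<open>
The element \<open>P(a) - P(0)\<close>, which exists without a unit.
\<close>

definition poly_elt :: "'a \<Rightarrow> real poly \<Rightarrow> 'a" where
  "poly_elt a P = poly_act a (poly_shift 1 P) a"

lemma poly_act_poly_elt: "poly_act a P h = of_real (poly P 0) *\<^sub>A h + poly_elt a P * h"
proof (cases P)
  case (pCons c Q)
  have "poly_shift 1 P = Q" unfolding pCons by (simp add: poly_eq_iff coeff_poly_shift)
  moreover have "a * poly_act a Q h = poly_act a Q a * h"
    by (metis mult_commute poly_act_mult_right)
  ultimately show ?thesis unfolding pCons poly_elt_def by simp
qed

lemma poly_elt_diff: "poly_elt a (P - Q) = poly_elt a P - poly_elt a Q"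
proof -
  have "poly_shift 1 (P - Q) = poly_shift 1 P - poly_shift 1 Q"
    by (simp add: poly_eq_iff coeff_poly_shift)
  then show ?thesis unfolding poly_elt_def by (simp add: poly_act_diff)
qed

text \<open>
Polynomials that converge to \<open>g\<close> uniformly on bounded sets. One sequence serves all seminorms,
although \<open>p(a)\<close> need not be bounded in \<open>p\<close>.
\<close>

definition approximant :: "(real \<Rightarrow> real) \<Rightarrow> nat \<Rightarrow> real poly" where
  "approximant g n = (SOME P. \<forall>t. \<bar>t\<bar> \<le> real (Suc n) \<longrightarrow> \<bar>g t - poly P t\<bar> \<le> inverse (real (Suc n)))"

lemma approximant:
  assumes "continuous_on UNIV g" "\<bar>t\<bar> \<le> real (Suc n)"
  shows "\<bar>g t - poly (approximant g n) t\<bar> \<le> inverse (real (Suc n))"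
proof -
  have "\<forall>t. \<bar>t\<bar> \<le> real (Suc n) \<longrightarrow> \<bar>g t - poly (approximant g n) t\<bar> \<le> inverse (real (Suc n))"
    unfolding approximant_def
    by (rule someI_ex[OF real_polynomial_approximation[OF assms(1)]]) simp
  with assms(2) show ?thesis by blast
qed

context
  fixes a :: 'a
  assumes sa: "star a = a"
begin

lemma seminorm_poly_act_self_adjoint:
  assumes p: "C_star_seminorm scaleA star p"
    and M: "\<And>t. \<bar>t\<bar> \<le> p a + 1 \<Longrightarrow> \<bar>poly P t\<bar> \<le> M"
  shows "p (poly_act a P h) \<le> M * p h"
  using seminorm_nonneg[OF p, of a] by (intro seminorm_poly_act[OF p sa _ _ M]) auto

text \<open>
The element \<open>x = P(a) - P(0)\<close> satisfies \<open>x\<^sup>2 = P(a) x - P(0) x\<close>, whence \<open>p(x)\<^sup>2 \<le> 2 M p(x)\<close>.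
\<close>

lemma seminorm_poly_elt:
  assumes p: "C_star_seminorm scaleA star p"
    and M: "\<And>t. \<bar>t\<bar> \<le> p a + 1 \<Longrightarrow> \<bar>poly P t\<bar> \<le> M"
  shows "p (poly_elt a P) \<le> 2 * M"
proof -
  let ?x = "poly_elt a P"
  have P0: "\<bar>poly P 0\<bar> \<le> M" using seminorm_nonneg[OF p, of a] by (intro M) auto
  have "?x * ?x = poly_act a P ?x - of_real (poly P 0) *\<^sub>A ?x"
    using poly_act_poly_elt[of a P ?x] by simp
  then have "(p ?x)\<^sup>2 \<le> p (poly_act a P ?x) + \<bar>poly P 0\<bar> * p ?x"
    using seminorm_diff[OF p] seminorm_square[OF p, of ?x]
    by (metis norm_of_real seminorm_scale[OF p])
  also have "\<dots> \<le> M * p ?x + M * p ?x"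
    using seminorm_nonneg[OF p, of ?x]
    by (intro add_mono seminorm_poly_act_self_adjoint[OF p M] mult_right_mono P0) auto
  finally have "p ?x * p ?x \<le> (2 * M) * p ?x" by (simp add: power2_eq_square)
  then show ?thesis
    using seminorm_nonneg[OF p, of ?x] P0 by (cases "p ?x = 0") auto
qed

lemma approximant_elt_converges:
  assumes g: "continuous_on UNIV g"
  shows "\<exists>b. \<forall>p\<in>seminorms. (\<lambda>n. p (poly_elt a (approximant g n) - b)) \<longlonglongrightarrow> 0"
proof (rule seminorms_Cauchy_converges)
  fix p and e :: real assume pS: "p \<in> seminorms" and e: "0 < e"
  note p = seminormsD[OF pS]
  obtain N where N: "p a + 1 \<le> real (Suc N)" "inverse (real (Suc N)) < e / 4"
  proof -
    obtain N1 where N1: "inverse (real (Suc N1)) < e / 4"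
      using reals_Archimedean[of "e/4"] e by auto
    obtain N2 where N2: "p a + 1 \<le> real N2" using real_arch_simple by blast
    have "inverse (real (Suc (max N1 N2))) \<le> inverse (real (Suc N1))"
      by (intro le_imp_inverse_le) auto
    then have "inverse (real (Suc (max N1 N2))) < e / 4" using N1 by linarith
    then show ?thesis using N2 by (intro that[of "max N1 N2"]) auto
  qed
  have "p (poly_elt a (approximant g m) - poly_elt a (approximant g n)) < e" if "m \<ge> N" "n \<ge> N" for m n
  proof -
    have near: "\<bar>g t - poly (approximant g k) t\<bar> \<le> inverse (real (Suc N))"
      if "\<bar>t\<bar> \<le> p a + 1" "k \<ge> N" for t k
    proof -
      have "\<bar>g t - poly (approximant g k) t\<bar> \<le> inverse (real (Suc k))"
        using that N(1) by (intro approximant g) auto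
      also have "\<dots> \<le> inverse (real (Suc N))" using that by (intro le_imp_inverse_le) auto
      finally show ?thesis .
    qed
    have "p (poly_elt a (approximant g m - approximant g n)) \<le> 2 * (2 * inverse (real (Suc N)))"
    proof (rule seminorm_poly_elt[OF p])
      fix t assume "\<bar>t\<bar> \<le> p a + 1"
      from near[OF this \<open>m \<ge> N\<close>] near[OF this \<open>n \<ge> N\<close>]
      show "\<bar>poly (approximant g m - approximant g n) t\<bar> \<le> 2 * inverse (real (Suc N))" by simp
    qed
    then show ?thesis using N(2) by (simp add: poly_elt_diff)
  qed
  then show "\<exists>N. \<forall>m\<ge>N. \<forall>n\<ge>N. p (poly_elt a (approximant g m) - poly_elt a (approximant g n)) < e"
    by blast
qed

text \<open>
The functional calculus of the self-adjoint element \<open>a\<close>: \<open>fcalc_elt g\<close> is \<open>g(a) - g(0)\<close>, an element of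
the algebra, and \<open>fcalc g h\<close> is \<open>g(a) h\<close>. Both are meaningful for continuous \<open>g\<close>. Bounds are stated on
\<open>[- p(a) - 1, p(a) + 1]\<close> rather than on \<open>[- p(a), p(a)]\<close>, so that the interval is never degenerate.
\<close>

definition fcalc_elt :: "(real \<Rightarrow> real) \<Rightarrow> 'a" where
  "fcalc_elt g = (SOME b. \<forall>p\<in>seminorms. (\<lambda>n. p (poly_elt a (approximant g n) - b)) \<longlonglongrightarrow> 0)"

definition fcalc :: "(real \<Rightarrow> real) \<Rightarrow> 'a \<Rightarrow> 'a" where
  "fcalc g h = of_real (g 0) *\<^sub>A h + fcalc_elt g * h"

lemma approximant_act_tendsto:
  assumes g: "continuous_on UNIV g" and pS: "p \<in> seminorms"
  shows "(\<lambda>n. p (poly_act a (approximant g n) h - fcalc g h)) \<longlonglongrightarrow> 0"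
proof (rule tendsto_sandwich[OF _ _ tendsto_const])
  note p = seminormsD[OF pS]
  let ?d = "\<lambda>n. p (poly_elt a (approximant g n) - fcalc_elt g)"
  have "?d \<longlonglongrightarrow> 0"
    using someI_ex[OF approximant_elt_converges[OF g]] pS unfolding fcalc_elt_def by blast
  then have "(\<lambda>n. inverse (real (Suc n)) * p h + ?d n * p h) \<longlonglongrightarrow> 0 * p h + 0 * p h"
    by (intro tendsto_intros LIMSEQ_inverse_real_of_nat)
  then show "(\<lambda>n. inverse (real (Suc n)) * p h + ?d n * p h) \<longlonglongrightarrow> 0" by simp
  show "\<forall>\<^sub>F n in sequentially. 0 \<le> p (poly_act a (approximant g n) h - fcalc g h)"
    by (simp add: seminorm_nonneg[OF p])
  show "\<forall>\<^sub>F n in sequentially. p (poly_act a (approximant g n) h - fcalc g h)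
      \<le> inverse (real (Suc n)) * p h + ?d n * p h"
  proof (rule always_eventually, rule allI)
    fix n
    define c where "c = poly (approximant g n) 0 - g 0"
    have "poly_act a (approximant g n) h - fcalc g h
        = of_real c *\<^sub>A h + (poly_elt a (approximant g n) - fcalc_elt g) * h"
      unfolding c_def poly_act_poly_elt fcalc_def
      by (simp add: scale_left_diff_distrib left_diff_distrib)
    then have "p (poly_act a (approximant g n) h - fcalc g h) \<le> \<bar>c\<bar> * p h + ?d n * p h"
      using seminorm_add[OF p] seminorm_mult[OF p] seminorm_scale[OF p, of "of_real c" h]
      by (metis (no_types, opaque_lifting) add_left_mono norm_of_real order.trans)
    also have "\<bar>c\<bar> \<le> inverse (real (Suc n))"
      unfolding c_def using approximant[OF g, of 0 n] by simp
    finally show "p (poly_act a (approximant g n) h - fcalc g h)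
        \<le> inverse (real (Suc n)) * p h + ?d n * p h"
      using seminorm_nonneg[OF p, of h] by (simp add: mult_right_mono)
  qed
qed

lemma seminorm_fcalc_diff_poly:
  assumes g: "continuous_on UNIV g" and pS: "p \<in> seminorms"
    and M: "\<And>t. \<bar>t\<bar> \<le> p a + 1 \<Longrightarrow> \<bar>g t - poly P t\<bar> \<le> M"
  shows "p (fcalc g h - poly_act a P h) \<le> M * p h"
proof -
  note p = seminormsD[OF pS]
  let ?A = "approximant g"
  let ?d = "\<lambda>n. p (poly_act a (?A n) h - fcalc g h)"
  have "(\<lambda>n. ?d n + (M + inverse (real (Suc n))) * p h) \<longlonglongrightarrow> 0 + (M + 0) * p h"
    by (intro tendsto_intros LIMSEQ_inverse_real_of_nat approximant_act_tendsto g pS)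
  moreover have "\<exists>N. \<forall>n\<ge>N. p (fcalc g h - poly_act a P h)
      \<le> ?d n + (M + inverse (real (Suc n))) * p h"
  proof -
    obtain N where N: "p a + 1 \<le> real N" using real_arch_simple by blast
    have "p (fcalc g h - poly_act a P h) \<le> ?d n + (M + inverse (real (Suc n))) * p h"
      if "n \<ge> N" for n
    proof -
      have "p (poly_act a (?A n - P) h) \<le> (M + inverse (real (Suc n))) * p h"
      proof (rule seminorm_poly_act_self_adjoint[OF p])
        fix t assume t: "\<bar>t\<bar> \<le> p a + 1"
        have "\<bar>g t - poly (?A n) t\<bar> \<le> inverse (real (Suc n))"
          using t N that by (intro approximant g) auto
        then show "\<bar>poly (?A n - P) t\<bar> \<le> M + inverse (real (Suc n))"
          using M[OF t] by simp
      qed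
      moreover have "fcalc g h - poly_act a P h
          = poly_act a (?A n - P) h - (poly_act a (?A n) h - fcalc g h)"
        by (simp add: poly_act_diff)
      then have "p (fcalc g h - poly_act a P h) \<le> p (poly_act a (?A n - P) h) + ?d n"
        by (simp only: seminorm_diff[OF p])
      ultimately show ?thesis by simp
    qed
    then show ?thesis by blast
  qed
  ultimately show ?thesis by (intro LIMSEQ_le_const) auto
qed

lemma seminorm_fcalc:
  assumes "continuous_on UNIV g" "p \<in> seminorms" "\<And>t. \<bar>t\<bar> \<le> p a + 1 \<Longrightarrow> \<bar>g t\<bar> \<le> M"
  shows "p (fcalc g h) \<le> M * p h"
  using seminorm_fcalc_diff_poly[of g p 0 M h] assms by simp

lemma fcalc_poly: "fcalc (poly P) h = poly_act a P h"
proof -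
  have "fcalc (poly P) h - poly_act a P h = 0"
  proof (rule eq_zero_if_seminorms_zero)
    fix p assume pS: "p \<in> seminorms"
    have "p (fcalc (poly P) h - poly_act a P h) \<le> 0 * p h"
      by (intro seminorm_fcalc_diff_poly pS continuous_intros) auto
    then show "p (fcalc (poly P) h - poly_act a P h) = 0"
      using seminorm_nonneg[OF seminormsD[OF pS]] by (simp add: order_antisym)
  qed
  then show ?thesis by simp
qed

lemma fcalc_eqI:
  assumes g: "continuous_on UNIV g"
    and approx: "\<And>p. p \<in> seminorms \<Longrightarrow> \<exists>C. \<forall>e. 0 < e \<longrightarrow> e \<le> 1 \<longrightarrow>
      (\<exists>P. (\<forall>t. \<bar>t\<bar> \<le> p a + 1 \<longrightarrow> \<bar>g t - poly P t\<bar> \<le> C * e) \<and> p (y - poly_act a P h) \<le> C * e)"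
  shows "fcalc g h = y"
proof -
  have "fcalc g h - y = 0"
  proof (rule eq_zero_if_seminorms_zero)
    fix p assume pS: "p \<in> seminorms"
    note p = seminormsD[OF pS]
    from approx[OF pS] obtain C where C: "\<And>e. 0 < e \<Longrightarrow> e \<le> 1 \<Longrightarrow>
      \<exists>P. (\<forall>t. \<bar>t\<bar> \<le> p a + 1 \<longrightarrow> \<bar>g t - poly P t\<bar> \<le> C * e) \<and> p (y - poly_act a P h) \<le> C * e"
      by blast
    have "p (fcalc g h - y) \<le> C * e * (p h + 1)" if e: "0 < e" "e \<le> 1" for e
    proof -
      obtain P where P: "\<And>t. \<bar>t\<bar> \<le> p a + 1 \<Longrightarrow> \<bar>g t - poly P t\<bar> \<le> C * e"
        "p (y - poly_act a P h) \<le> C * e"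
        using C[OF e] by blast
      have "p (fcalc g h - y) \<le> p (fcalc g h - poly_act a P h) + p (y - poly_act a P h)"
        using seminorm_diff[OF p, of "fcalc g h - poly_act a P h" "y - poly_act a P h"] by simp
      also have "p (fcalc g h - poly_act a P h) \<le> (C * e) * p h"
        by (rule seminorm_fcalc_diff_poly[OF g pS P(1)])
      finally show ?thesis using P(2) by (simp add: algebra_simps)
    qed
    then have "eventually (\<lambda>e. p (fcalc g h - y) \<le> C * e * (p h + 1)) (at_right 0)"
      by (auto simp: eventually_at_right_field intro!: exI[of _ 1])
    moreover have "((\<lambda>e. C * e * (p h + 1)) \<longlongrightarrow> C * 0 * (p h + 1)) (at_right 0)"
      by (intro tendsto_intros)
    ultimately have "p (fcalc g h - y) \<le> C * 0 * (p h + 1)"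
      by (intro tendsto_lowerbound) auto
    then show "p (fcalc g h - y) = 0"
      using seminorm_nonneg[OF p, of "fcalc g h - y"] by simp
  qed
  then show ?thesis by simp
qed

lemma bounded_on_interval:
  assumes "continuous_on UNIV (g :: real \<Rightarrow> real)"
  obtains M where "0 \<le> M" "\<And>t. \<bar>t\<bar> \<le> r \<Longrightarrow> \<bar>g t\<bar> \<le> M"
proof -
  have "compact (g ` {-r..r})"
    using assms by (intro compact_continuous_image continuous_on_subset[OF assms]) auto
  then obtain B where "\<forall>x\<in>g ` {-r..r}. norm x \<le> B"
    using compact_imp_bounded bounded_iff by blast
  moreover have "g t \<in> g ` {-r..r}" if "\<bar>t\<bar> \<le> r" for t
    using that by (intro imageI) auto
  ultimately have "\<bar>g t\<bar> \<le> \<bar>B\<bar>" if "\<bar>t\<bar> \<le> r" for t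
    using that by (metis abs_ge_self order.trans real_norm_def)
  then show ?thesis by (intro that[of "\<bar>B\<bar>"]) auto
qed

lemma fcalc_add:
  assumes g: "continuous_on UNIV g1" "continuous_on UNIV g2"
  shows "fcalc (\<lambda>t. g1 t + g2 t) h = fcalc g1 h + fcalc g2 h"
proof (rule fcalc_eqI)
  show "continuous_on UNIV (\<lambda>t. g1 t + g2 t)" by (intro continuous_intros g)
  fix p assume pS: "p \<in> seminorms"
  note p = seminormsD[OF pS]
  define C where "C = 2 * p h + 2"
  have "\<exists>P. (\<forall>t. \<bar>t\<bar> \<le> p a + 1 \<longrightarrow> \<bar>g1 t + g2 t - poly P t\<bar> \<le> C * e) \<and>
      p (fcalc g1 h + fcalc g2 h - poly_act a P h) \<le> C * e" if e: "0 < e" "e \<le> 1" for e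
  proof -
    obtain P1 P2 where P1: "\<And>t. \<bar>t\<bar> \<le> p a + 1 \<Longrightarrow> \<bar>g1 t - poly P1 t\<bar> \<le> e"
      and P2: "\<And>t. \<bar>t\<bar> \<le> p a + 1 \<Longrightarrow> \<bar>g2 t - poly P2 t\<bar> \<le> e"
      using real_polynomial_approximation[OF g(1) e(1)] real_polynomial_approximation[OF g(2) e(1)]
      by metis
    have Ce: "2 * e \<le> C * e" "2 * (e * p h) \<le> C * e"
      unfolding C_def using e seminorm_nonneg[OF p, of h] by (auto simp: algebra_simps)
    have "\<bar>g1 t + g2 t - poly (P1 + P2) t\<bar> \<le> C * e" if "\<bar>t\<bar> \<le> p a + 1" for t
      using P1[OF that] P2[OF that] Ce(1) by simp
    moreover have "fcalc g1 h + fcalc g2 h - poly_act a (P1 + P2) h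
        = (fcalc g1 h - poly_act a P1 h) + (fcalc g2 h - poly_act a P2 h)"
      by (simp add: poly_act_add)
    then have "p (fcalc g1 h + fcalc g2 h - poly_act a (P1 + P2) h)
        \<le> p (fcalc g1 h - poly_act a P1 h) + p (fcalc g2 h - poly_act a P2 h)"
      by (simp only: seminorm_add[OF p])
    then have "p (fcalc g1 h + fcalc g2 h - poly_act a (P1 + P2) h) \<le> C * e"
      using seminorm_fcalc_diff_poly[OF g(1) pS P1, of h] seminorm_fcalc_diff_poly[OF g(2) pS P2, of h]
        Ce(2) by simp
    ultimately show ?thesis by blast
  qed
  then show "\<exists>C. \<forall>e. 0 < e \<longrightarrow> e \<le> 1 \<longrightarrow>
      (\<exists>P. (\<forall>t. \<bar>t\<bar> \<le> p a + 1 \<longrightarrow> \<bar>g1 t + g2 t - poly P t\<bar> \<le> C * e) \<and>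
        p (fcalc g1 h + fcalc g2 h - poly_act a P h) \<le> C * e)" by blast
qed

lemma fcalc_mult:
  assumes g: "continuous_on UNIV g1" "continuous_on UNIV g2"
  shows "fcalc (\<lambda>t. g1 t * g2 t) h = fcalc g1 (fcalc g2 h)"
proof (rule fcalc_eqI)
  show "continuous_on UNIV (\<lambda>t. g1 t * g2 t)" by (intro continuous_intros g)
  fix p assume pS: "p \<in> seminorms"
  note p = seminormsD[OF pS]
  obtain M1 where M1: "0 \<le> M1" "\<And>t. \<bar>t\<bar> \<le> p a + 1 \<Longrightarrow> \<bar>g1 t\<bar> \<le> M1"
    using bounded_on_interval[OF g(1)] by blast
  obtain M2 where M2: "0 \<le> M2" "\<And>t. \<bar>t\<bar> \<le> p a + 1 \<Longrightarrow> \<bar>g2 t\<bar> \<le> M2"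
    using bounded_on_interval[OF g(2)] by blast
  define C where "C = (M1 + M2 + 1) + (p (fcalc g2 h) + (M1 + 1) * p h)"
  have "\<exists>P. (\<forall>t. \<bar>t\<bar> \<le> p a + 1 \<longrightarrow> \<bar>g1 t * g2 t - poly P t\<bar> \<le> C * e) \<and>
      p (fcalc g1 (fcalc g2 h) - poly_act a P h) \<le> C * e" if e: "0 < e" "e \<le> 1" for e
  proof -
    obtain P1 P2 where P1: "\<And>t. \<bar>t\<bar> \<le> p a + 1 \<Longrightarrow> \<bar>g1 t - poly P1 t\<bar> \<le> e"
      and P2: "\<And>t. \<bar>t\<bar> \<le> p a + 1 \<Longrightarrow> \<bar>g2 t - poly P2 t\<bar> \<le> e"
      using real_polynomial_approximation[OF g(1) e(1)] real_polynomial_approximation[OF g(2) e(1)]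
      by metis
    have Ce: "(M1 + M2 + 1) * e \<le> C * e" "(p (fcalc g2 h) + (M1 + 1) * p h) * e \<le> C * e"
      unfolding C_def using e seminorm_nonneg[OF p] M1(1) M2(1)
      by (auto intro!: mult_right_mono)
    have "\<bar>g1 t * g2 t - poly (P1 * P2) t\<bar> \<le> C * e" if t: "\<bar>t\<bar> \<le> p a + 1" for t
    proof -
      have "\<bar>g1 t * g2 t - poly (P1 * P2) t\<bar>
          = \<bar>g1 t * (g2 t - poly P2 t) + (g1 t - poly P1 t) * poly P2 t\<bar>"
        by (simp add: algebra_simps)
      also have "\<dots> \<le> \<bar>g1 t\<bar> * \<bar>g2 t - poly P2 t\<bar> + \<bar>g1 t - poly P1 t\<bar> * \<bar>poly P2 t\<bar>"
        by (metis abs_mult abs_triangle_ineq)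
      also have "\<dots> \<le> M1 * e + e * (M2 + 1)"
        using M1 M2(1) M2(2)[OF t] P1[OF t] P2[OF t] t e
        by (intro add_mono mult_mono) auto
      also have "\<dots> \<le> C * e" using Ce(1) by (simp add: algebra_simps)
      finally show ?thesis .
    qed
    moreover have "p (fcalc g1 (fcalc g2 h) - poly_act a (P1 * P2) h) \<le> C * e"
    proof -
      let ?y = "fcalc g2 h"
      have "fcalc g1 ?y - poly_act a (P1 * P2) h
          = (fcalc g1 ?y - poly_act a P1 ?y) + poly_act a P1 (?y - poly_act a P2 h)"
        by (simp add: poly_act_mult poly_act_diff_right)
      then have "p (fcalc g1 ?y - poly_act a (P1 * P2) h)
          \<le> p (fcalc g1 ?y - poly_act a P1 ?y) + p (poly_act a P1 (?y - poly_act a P2 h))"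
        using seminorm_add[OF p] by metis
      also have "p (fcalc g1 ?y - poly_act a P1 ?y) \<le> e * p ?y"
        by (rule seminorm_fcalc_diff_poly[OF g(1) pS P1])
      also have "p (poly_act a P1 (?y - poly_act a P2 h)) \<le> (M1 + 1) * p (?y - poly_act a P2 h)"
      proof (rule seminorm_poly_act_self_adjoint[OF p])
        fix t assume "\<bar>t\<bar> \<le> p a + 1"
        from P1[OF this] M1(2)[OF this] e show "\<bar>poly P1 t\<bar> \<le> M1 + 1" by simp
      qed
      also have "(M1 + 1) * p (?y - poly_act a P2 h) \<le> (M1 + 1) * (e * p h)"
        using M1(1) by (intro mult_left_mono seminorm_fcalc_diff_poly[OF g(2) pS P2]) auto
      also have "e * p ?y + (M1 + 1) * (e * p h) \<le> C * e"
        using Ce(2) by (simp add: algebra_simps)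
      finally show ?thesis by simp
    qed
    ultimately show ?thesis by blast
  qed
  then show "\<exists>C. \<forall>e. 0 < e \<longrightarrow> e \<le> 1 \<longrightarrow>
      (\<exists>P. (\<forall>t. \<bar>t\<bar> \<le> p a + 1 \<longrightarrow> \<bar>g1 t * g2 t - poly P t\<bar> \<le> C * e) \<and>
        p (fcalc g1 (fcalc g2 h) - poly_act a P h) \<le> C * e)" by blast
qed

lemma fcalc_mult_right: "fcalc g h * k = fcalc g (h * k)"
  unfolding fcalc_def by (simp add: distrib_right scale_mult_left mult.assoc)

section \<open>Elements divisible by functions vanishing at each point\<close>

text \<open>
The power \<open>x\<^bsup>2^m\<^esup>\<close>; without a unit there is no general power operation.
\<close>

primrec iterated_square :: "nat \<Rightarrow> 'a \<Rightarrow> 'a" where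
  "iterated_square 0 x = x"
| "iterated_square (Suc m) x = iterated_square m x * iterated_square m x"

lemma seminorm_iterated_square:
  assumes "C_star_seminorm scaleA star p"
  shows "p (iterated_square m x) = (p x) ^ (2 ^ m)"
  by (induction m) (simp_all add: seminorm_square[OF assms] flip: power_mult, simp add: mult.commute)

lemma iterated_square_fcalc:
  assumes g: "continuous_on UNIV g"
  shows "iterated_square m (fcalc g x) = fcalc (\<lambda>t. g t ^ (2 ^ m)) (iterated_square m x)"
proof (induction m)
  case (Suc m)
  let ?g = "\<lambda>t. g t ^ (2 ^ m)" and ?y = "iterated_square m x"
  have c: "continuous_on UNIV ?g" by (intro continuous_intros g)
  have "fcalc ?g ?y * fcalc ?g ?y = fcalc ?g (fcalc ?g (?y * ?y))"
    by (metis fcalc_mult_right mult_commute)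
  also have "\<dots> = fcalc (\<lambda>t. ?g t * ?g t) (?y * ?y)"
    by (rule fcalc_mult[OF c c, symmetric])
  finally show ?case unfolding iterated_square.simps Suc
    by (simp add: mult_2 power_add)
qed simp

text \<open>
A maximum principle for the partition of unity \<open>\<theta> + (1 - \<theta>) = 1\<close>: if \<open>p(\<psi>(a) x) \<le> e\<close> for every cut-off \<open>\<psi>\<close> that
vanishes with \<open>\<theta>\<close> and for every one that vanishes with \<open>1 - \<theta>\<close>, then \<open>p(x) \<le> e\<close>. The triangle inequality alone would lose a factor \<open>2\<close>; it is applied to the
\<open>N\<close>-th power \<open>x\<^sup>N = \<theta> x\<^sup>N + (1 - \<theta>) x\<^sup>N\<close> with \<open>\<theta> x\<^sup>N = (\<theta>\<^bsup>1/N\<^esup> x)\<^sup>N\<close>, and \<open>N\<close> tends to infinity.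
\<close>

lemma seminorm_fcalc_partition:
  assumes pS: "p \<in> seminorms" and e: "0 < e"
    and \<theta>: "continuous_on UNIV (\<theta> :: real \<Rightarrow> real)" "\<And>t. 0 \<le> \<theta> t" "\<And>t. \<theta> t \<le> 1"
    and small: "\<And>\<psi>. continuous_on UNIV \<psi> \<Longrightarrow> (\<And>t. 0 \<le> \<psi> t) \<Longrightarrow> (\<And>t. \<psi> t \<le> 1) \<Longrightarrow>
      (\<And>t. \<theta> t = 0 \<Longrightarrow> \<psi> t = 0) \<Longrightarrow> p (fcalc \<psi> x) \<le> e"
    and small': "\<And>\<psi>. continuous_on UNIV \<psi> \<Longrightarrow> (\<And>t. 0 \<le> \<psi> t) \<Longrightarrow> (\<And>t. \<psi> t \<le> 1) \<Longrightarrow>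
      (\<And>t. \<theta> t = 1 \<Longrightarrow> \<psi> t = 0) \<Longrightarrow> p (fcalc \<psi> x) \<le> e"
  shows "p x \<le> e"
proof (rule ccontr)
  note p = seminormsD[OF pS]
  assume "\<not> p x \<le> e"
  then have "1 < p x / e" using e by simp
  then obtain m where "2 < (p x / e) ^ m" using real_arch_pow by blast
  also have "\<dots> \<le> (p x / e) ^ (2 ^ m)"
    using \<open>1 < p x / e\<close> by (intro power_increasing) (auto simp: less_imp_le)
  finally have "2 * e ^ (2 ^ m) < (p x) ^ (2 ^ m)"
    using e by (simp add: power_divide field_simps)
  let ?N = "2 ^ m :: nat" and ?y = "iterated_square m x"
  have piece: "p (fcalc \<phi> ?y) \<le> e ^ ?N"
    if \<phi>: "continuous_on UNIV \<phi>" "\<And>t. 0 \<le> \<phi> t" "\<And>t. \<phi> t \<le> 1"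
      and sm: "\<And>\<psi>. continuous_on UNIV \<psi> \<Longrightarrow> (\<And>t. 0 \<le> \<psi> t) \<Longrightarrow> (\<And>t. \<psi> t \<le> 1) \<Longrightarrow>
        (\<And>t. \<phi> t = 0 \<Longrightarrow> \<psi> t = 0) \<Longrightarrow> p (fcalc \<psi> x) \<le> e" for \<phi>
  proof -
    let ?\<psi> = "\<lambda>t. root ?N (\<phi> t)"
    have c: "continuous_on UNIV ?\<psi>" by (intro continuous_intros \<phi>)
    have "fcalc \<phi> ?y = iterated_square m (fcalc ?\<psi> x)"
      by (simp add: iterated_square_fcalc[OF c] real_root_pow_pos2 \<phi>)
    then have "p (fcalc \<phi> ?y) = (p (fcalc ?\<psi> x)) ^ ?N"
      by (simp add: seminorm_iterated_square[OF p])
    also have "\<dots> \<le> e ^ ?N"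
      using \<phi> by (intro power_mono seminorm_nonneg[OF p] sm c) (auto simp: real_root_ge_zero)
    finally show ?thesis .
  qed
  have "?y = fcalc (poly 1) ?y" by (simp add: fcalc_poly)
  also have "poly 1 = (\<lambda>t. \<theta> t + (1 - \<theta> t))" by auto
  also have "fcalc \<dots> ?y = fcalc \<theta> ?y + fcalc (\<lambda>t. 1 - \<theta> t) ?y"
    by (intro fcalc_add continuous_intros \<theta>)
  finally have "p ?y = p (fcalc \<theta> ?y + fcalc (\<lambda>t. 1 - \<theta> t) ?y)"
    by (rule arg_cong)
  also have "\<dots> \<le> p (fcalc \<theta> ?y) + p (fcalc (\<lambda>t. 1 - \<theta> t) ?y)"
    by (rule seminorm_add[OF p])
  also have "\<dots> \<le> e ^ ?N + e ^ ?N"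
  proof (intro add_mono piece)
    show "p (fcalc \<psi> x) \<le> e" if "continuous_on UNIV \<psi>" "\<And>t. 0 \<le> \<psi> t" "\<And>t. \<psi> t \<le> 1"
      "\<And>t. 1 - \<theta> t = 0 \<Longrightarrow> \<psi> t = 0" for \<psi>
      using that by (intro small') auto
    show "p (fcalc \<psi> x) \<le> e" if "continuous_on UNIV \<psi>" "\<And>t. 0 \<le> \<psi> t" "\<And>t. \<psi> t \<le> 1"
      "\<And>t. \<theta> t = 0 \<Longrightarrow> \<psi> t = 0" for \<psi>
      using that by (intro small) auto
  qed (use \<theta> in \<open>auto intro: continuous_on_diff\<close>)
  finally show False
    using \<open>2 * e ^ (2 ^ m) < (p x) ^ (2 ^ m)\<close> by (simp add: seminorm_iterated_square[OF p])
qed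

text \<open>
If for every real \<open>s\<close> the element \<open>h\<close> is divisible by some \<open>w(a)\<close> with \<open>w(s) = 0\<close>, then \<open>h\<close> vanishes. This replaces the
evaluation of \<open>h\<close> at characters: near \<open>s\<close> the element \<open>h\<close> is small, and by the maximum principle
intervals on which \<open>h\<close> is small can be joined, so that bisection shows \<open>h\<close> to be small everywhere.
\<close>

lemma eq_zero_if_locally_divisible:
  assumes div: "\<And>s. \<exists>w k. continuous_on UNIV w \<and> w s = 0 \<and> h = fcalc w k"
  shows "h = 0"
proof (rule eq_zero_if_seminorms_zero)
  fix p assume pS: "p \<in> seminorms"
  note p = seminormsD[OF pS]
  have "p h \<le> e" if e: "0 < e" for e
  proof -
    \<comment> \<open>The margin \<open>\<eta>\<close> makes adjacent intervals overlap, which leaves room for a continuous cut-off.\<close>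
    define Small where "Small = (\<lambda>c d. \<exists>\<eta>>0. \<forall>g. continuous_on UNIV g \<longrightarrow> (\<forall>t. 0 \<le> g t \<and> g t \<le> 1) \<longrightarrow>
      (\<forall>t. \<bar>t\<bar> \<le> p a + 1 \<longrightarrow> g t \<noteq> 0 \<longrightarrow> c - \<eta> \<le> t \<and> t \<le> d + \<eta>) \<longrightarrow> p (fcalc g h) \<le> e)"
    have "- (p a + 1) \<le> p a + 1" using seminorm_nonneg[OF p, of a] by simp
    then have "Small (- (p a + 1)) (p a + 1)"
    proof (induction rule: Bolzano)
      case (trans b c d)
      from trans(1) obtain \<eta>1 where \<eta>1: "0 < \<eta>1" and s1: "\<forall>g. continuous_on UNIV g \<longrightarrow>
        (\<forall>t. 0 \<le> g t \<and> g t \<le> 1) \<longrightarrow>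
        (\<forall>t. \<bar>t\<bar> \<le> p a + 1 \<longrightarrow> g t \<noteq> 0 \<longrightarrow> b - \<eta>1 \<le> t \<and> t \<le> c + \<eta>1) \<longrightarrow> p (fcalc g h) \<le> e"
        unfolding Small_def by (elim exE conjE)
      from trans(2) obtain \<eta>2 where \<eta>2: "0 < \<eta>2" and s2: "\<forall>g. continuous_on UNIV g \<longrightarrow>
        (\<forall>t. 0 \<le> g t \<and> g t \<le> 1) \<longrightarrow>
        (\<forall>t. \<bar>t\<bar> \<le> p a + 1 \<longrightarrow> g t \<noteq> 0 \<longrightarrow> c - \<eta>2 \<le> t \<and> t \<le> d + \<eta>2) \<longrightarrow> p (fcalc g h) \<le> e"
        unfolding Small_def by (elim exE conjE)
      define \<eta> where "\<eta> = min \<eta>1 \<eta>2"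
      have \<eta>: "0 < \<eta>" "\<eta> \<le> \<eta>1" "\<eta> \<le> \<eta>2" using \<eta>1 \<eta>2 unfolding \<eta>_def by auto
      define \<theta> where "\<theta> = (\<lambda>t. max 0 (min 1 ((c + \<eta> - t) / \<eta>)))"
      have \<theta>: "continuous_on UNIV \<theta>" "\<And>t. 0 \<le> \<theta> t" "\<And>t. \<theta> t \<le> 1"
        unfolding \<theta>_def by (intro continuous_intros) (use \<eta>(1) in auto)
      have \<theta>0: "\<theta> t = 0" if "c + \<eta> < t" for t
      proof -
        have "(c + \<eta> - t) / \<eta> \<le> 0" using that \<eta>(1) by (intro divide_nonpos_pos) auto
        then show ?thesis unfolding \<theta>_def by auto
      qed
      have \<theta>1: "\<theta> t = 1" if "t < c" for t
      proof -
        have "1 \<le> (c + \<eta> - t) / \<eta>" using that \<eta>(1) by (simp add: field_simps)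
        then show ?thesis unfolding \<theta>_def by auto
      qed
      have "p (fcalc g h) \<le> e" if g: "continuous_on UNIV g" "\<And>t. 0 \<le> g t" "\<And>t. g t \<le> 1"
        and supp: "\<And>t. \<bar>t\<bar> \<le> p a + 1 \<Longrightarrow> g t \<noteq> 0 \<Longrightarrow> b - \<eta> \<le> t \<and> t \<le> d + \<eta>" for g
      proof (rule seminorm_fcalc_partition[OF pS e \<theta>])
        fix \<psi> :: "real \<Rightarrow> real"
        assume \<psi>: "continuous_on UNIV \<psi>" "\<And>t. 0 \<le> \<psi> t" "\<And>t. \<psi> t \<le> 1"
          and \<psi>0: "\<And>t. \<theta> t = 0 \<Longrightarrow> \<psi> t = 0"
        have "p (fcalc (\<lambda>t. \<psi> t * g t) h) \<le> e"
        proof (rule s1[rule_format])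
          show "b - \<eta>1 \<le> t \<and> t \<le> c + \<eta>1" if "\<bar>t\<bar> \<le> p a + 1" "\<psi> t * g t \<noteq> 0" for t
            using supp[of t] \<psi>0[of t] \<theta>0[of t] that \<eta> by fastforce
          show "continuous_on UNIV (\<lambda>t. \<psi> t * g t)" by (intro continuous_intros \<psi> g)
          show "0 \<le> \<psi> t * g t \<and> \<psi> t * g t \<le> 1" for t by (simp add: mult_le_one \<psi> g)
        qed
        then show "p (fcalc \<psi> (fcalc g h)) \<le> e" by (simp add: fcalc_mult \<psi> g)
      next
        fix \<psi> :: "real \<Rightarrow> real"
        assume \<psi>: "continuous_on UNIV \<psi>" "\<And>t. 0 \<le> \<psi> t" "\<And>t. \<psi> t \<le> 1"
          and \<psi>0: "\<And>t. \<theta> t = 1 \<Longrightarrow> \<psi> t = 0"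
        have "p (fcalc (\<lambda>t. \<psi> t * g t) h) \<le> e"
        proof (rule s2[rule_format])
          show "c - \<eta>2 \<le> t \<and> t \<le> d + \<eta>2" if "\<bar>t\<bar> \<le> p a + 1" "\<psi> t * g t \<noteq> 0" for t
            using supp[of t] \<psi>0[of t] \<theta>1[of t] that \<eta> by fastforce
          show "continuous_on UNIV (\<lambda>t. \<psi> t * g t)" by (intro continuous_intros \<psi> g)
          show "0 \<le> \<psi> t * g t \<and> \<psi> t * g t \<le> 1" for t by (simp add: mult_le_one \<psi> g)
        qed
        then show "p (fcalc \<psi> (fcalc g h)) \<le> e" by (simp add: fcalc_mult \<psi> g)
      qed
      then have "\<forall>g. continuous_on UNIV g \<longrightarrow> (\<forall>t. 0 \<le> g t \<and> g t \<le> 1) \<longrightarrow>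
          (\<forall>t. \<bar>t\<bar> \<le> p a + 1 \<longrightarrow> g t \<noteq> 0 \<longrightarrow> b - \<eta> \<le> t \<and> t \<le> d + \<eta>) \<longrightarrow> p (fcalc g h) \<le> e"
        by simp
      then show ?case unfolding Small_def using \<eta>(1) by (intro exI conjI)
    next
      case (local s)
      obtain w k where w: "continuous_on UNIV w" "w s = 0" and h: "h = fcalc w k"
        using div by blast
      have "0 < e / (p k + 1)" using e seminorm_nonneg[OF p, of k] by (intro divide_pos_pos) auto
      then obtain \<delta> where "0 < \<delta>" and \<delta>: "\<And>t. \<bar>t - s\<bar> < \<delta> \<Longrightarrow> \<bar>w t\<bar> \<le> e / (p k + 1)"
        using w continuous_on_iff[of UNIV w] by (metis UNIV_I dist_real_def diff_zero less_imp_le)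
      have "Small c d" if cd: "c \<le> s" "s \<le> d" "d - c < \<delta> / 2" for c d
        unfolding Small_def
      proof (intro exI[of _ "\<delta> / 2"] conjI allI impI)
        fix g :: "real \<Rightarrow> real"
        assume g: "continuous_on UNIV g" "\<forall>t. 0 \<le> g t \<and> g t \<le> 1"
          and supp: "\<forall>t. \<bar>t\<bar> \<le> p a + 1 \<longrightarrow> g t \<noteq> 0 \<longrightarrow> c - \<delta> / 2 \<le> t \<and> t \<le> d + \<delta> / 2"
        have "p (fcalc (\<lambda>t. g t * w t) k) \<le> e / (p k + 1) * p k"
        proof (rule seminorm_fcalc[OF _ pS])
          fix t assume t: "\<bar>t\<bar> \<le> p a + 1"
          show "\<bar>g t * w t\<bar> \<le> e / (p k + 1)"
          proof (cases "g t = 0")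
            case True
            then show ?thesis using \<open>0 < e / (p k + 1)\<close> by simp
          next
            case False
            then have "c - \<delta> / 2 \<le> t \<and> t \<le> d + \<delta> / 2" using supp t by blast
            then have "\<bar>t - s\<bar> < \<delta>" using cd by linarith
            then have "\<bar>g t\<bar> * \<bar>w t\<bar> \<le> 1 * (e / (p k + 1))"
              using g(2) \<delta> by (intro mult_mono) auto
            then show ?thesis by (simp add: abs_mult)
          qed
        qed (intro continuous_intros g w)
        also have "\<dots> \<le> e"
          using e seminorm_nonneg[OF p, of k] by (simp add: field_simps)
        finally show "p (fcalc g h) \<le> e" unfolding h by (simp add: fcalc_mult g w)
      qed (use \<open>0 < \<delta>\<close> in simp)
      then show ?case using \<open>0 < \<delta>\<close> by (intro exI[of _ "\<delta> / 2"]) auto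
    qed
    then obtain \<eta> where "0 < \<eta>" and s: "\<forall>g. continuous_on UNIV g \<longrightarrow> (\<forall>t. 0 \<le> g t \<and> g t \<le> 1) \<longrightarrow>
        (\<forall>t. \<bar>t\<bar> \<le> p a + 1 \<longrightarrow> g t \<noteq> 0 \<longrightarrow> - (p a + 1) - \<eta> \<le> t \<and> t \<le> p a + 1 + \<eta>) \<longrightarrow>
        p (fcalc g h) \<le> e"
      unfolding Small_def by (elim exE conjE)
    then have "p (fcalc (poly 1) h) \<le> e"
      by (intro s[rule_format] continuous_intros) auto
    then show ?thesis by (simp add: fcalc_poly)
  qed
  then have "p h \<le> 0" by (rule field_le_epsilon[of _ 0, simplified])
  then show "p h = 0" using seminorm_nonneg[OF p, of h] by simp
qed

end

end

section \<open>Hilbert bimodules over commutative algebras\<close>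

locale commutative_Hilbert_bimodule = Hilbert_bimodule + commutative_pro_C_star_algebra
begin

lemma rinner_zero_right: "rinner x 0 = 0"
  using rinner_add[of x 0 0] by simp

lemma rinner_minus_right: "rinner x (- y) = - rinner x y"
  using rinner_add[of x y "- y"] by (simp add: rinner_zero_right eq_neg_iff_add_eq_0 add.commute)

lemma rinner_diff_right: "rinner x (y - z) = rinner x y - rinner x z"
  using rinner_add[of x y "- z"] by (simp add: rinner_minus_right)

lemma rinner_add_left: "rinner (x + y) z = rinner x z + rinner y z"
  by (metis rinner_add rinner_star star_add)

lemma rinner_diff_left: "rinner (x - y) z = rinner x z - rinner y z"
  by (metis rinner_diff_right rinner_star star_diff)

lemma rinner_scale_left: "rinner (scaleE c x) y = cnj c *\<^sub>A rinner x y"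
  by (metis rinner_scale rinner_star star_scale)

lemma rinner_ract_left: "rinner (ract x a) y = star a * rinner x y"
  by (metis rinner_ract rinner_star star_mult)

lemma ract_zero_left: "ract 0 a = 0"
  using ract_add_left[of 0 0 a] by simp

lemma ract_diff_left: "ract (x - y) a = ract x a - ract y a"
  using ract_add_left[of "x - y" y a] by simp

lemma ract_diff_right: "ract x (a - b) = ract x a - ract x b"
  using ract_add_right[of x "a - b" b] by simp

lemma linner_diff_left: "linner (x - y) z = linner x z - linner y z"
  using linner_add[of "x - y" y z] by simp

lemma star_mult_self_zero:
  assumes "star a * a = 0"
  shows "a = 0"
proof (rule eq_zero_if_seminorms_zero)
  fix p assume "p \<in> seminorms"
  then have p: "C_star_seminorm scaleA star p" by (rule seminormsD)
  show "p a = 0" using seminorm_star_mult[OF p, of a] seminorm_zero[OF p] assms by simp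
qed

lemma eq_if_rinner_eq:
  assumes "\<And>z. rinner u z = rinner v z"
  shows "u = v"
proof -
  have "rinner (u - v) (u - v) = 0" by (simp add: rinner_diff_left assms)
  then show ?thesis by (simp add: rinner_eq_0)
qed

lemma eq_if_linner_eq:
  assumes "\<And>z. linner u z = linner v z"
  shows "u = v"
proof -
  have "linner (u - v) (u - v) = 0" by (simp add: linner_diff_left assms)
  then show ?thesis by (simp add: linner_eq_0)
qed

lemma ract_rinner_self_zero:
  assumes "ract u (rinner u u) = 0"
  shows "u = 0"
proof -
  have "star (rinner u u) * rinner u u = rinner u (ract u (rinner u u))"
    by (metis rinner_ract rinner_star)
  also have "\<dots> = 0" by (simp only: assms rinner_zero_right)
  finally have "rinner u u = 0" by (rule star_mult_self_zero)
  then show ?thesis by (simp add: rinner_eq_0)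
qed

text \<open>
Over a commutative algebra the maps \<open>z \<mapsto> x\<langle>y, z\<rangle>\<close> are left multiplications by elements \<open>linner x y\<close>, hence
commute with one another. As a consequence the module behaves like one of rank one.
\<close>

lemma ract_rinner_swap: "ract x (rinner y z) = ract z (rinner y x)"
proof -
  define d where "d = ract x (rinner y z) - ract z (rinner y x)"
  have kill: "ract d (rinner y v) = 0" for v
  proof -
    have "ract (ract x (rinner y z)) (rinner y v) = lact (linner x y) (lact (linner z y) v)"
      by (metis inner_compatible ract_mult rinner_ract)
    also have "\<dots> = lact (linner z y) (lact (linner x y) v)"
      by (metis lact_mult mult_commute)
    also have "\<dots> = ract (ract z (rinner y x)) (rinner y v)"
      by (metis inner_compatible ract_mult rinner_ract)
    finally show ?thesis unfolding d_def by (simp add: ract_diff_left)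
  qed
  have "rinner d d = rinner y z * rinner d x - rinner y x * rinner d z"
  proof -
    have "rinner d d = rinner d (ract x (rinner y z) - ract z (rinner y x))"
      by (simp only: d_def)
    also have "\<dots> = rinner d x * rinner y z - rinner d z * rinner y x"
      by (simp only: rinner_diff_right rinner_ract)
    finally show ?thesis by (simp only: mult_commute)
  qed
  then have "ract d (rinner d d) = 0"
    by (simp add: ract_diff_right ract_mult kill ract_zero_left)
  then have "d = 0" by (rule ract_rinner_self_zero)
  then show ?thesis by (simp add: d_def)
qed

text \<open>
The Cauchy-Schwarz inequality holds with equality, which gives it for the seminorms without any order
structure on the algebra.
\<close>

lemma rinner_mult_rinner: "rinner y x * rinner x y = rinner y y * rinner x x"
  using ract_rinner_swap[of x x y] by (metis rinner_ract)

text \<open>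
The left action is by adjointable maps, with respect to the right inner product; this is not among the axioms of a bimodule.
\<close>

lemma lact_adjoint: "rinner (lact b u) z = rinner u (lact (star b) z)"
proof -
  define d where "d = rinner (lact b u) z - rinner u (lact (star b) z)"
  have kill: "rinner w v * d = 0" for v w
  proof -
    have "linner v (lact b u) = linner v u * star b"
      by (metis linner_lact linner_star star_mult)
    then have "ract v (rinner (lact b u) z) = ract v (rinner u (lact (star b) z))"
      by (metis inner_compatible lact_mult)
    then show ?thesis
      unfolding d_def by (metis right_diff_distrib rinner_ract diff_self)
  qed
  have "star d = rinner z (lact b u) - rinner (lact (star b) z) u"
    unfolding d_def by (metis rinner_star star_diff)
  then have "star d * d = 0" by (simp add: left_diff_distrib kill)
  then have "d = 0" by (rule star_mult_self_zero)
  then show ?thesis by (simp add: d_def)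
qed

subsection \<open>Module seminorms\<close>

context
  fixes p
  assumes pS: "p \<in> seminorms"
begin

lemma module_seminorm_nonneg: "0 \<le> module_seminorm rinner p x"
  unfolding module_seminorm_def by (simp add: seminorm_nonneg[OF seminormsD[OF pS]])

lemma module_seminorm_square: "(module_seminorm rinner p x)\<^sup>2 = p (rinner x x)"
  unfolding module_seminorm_def by (simp add: seminorm_nonneg[OF seminormsD[OF pS]])

lemma module_seminorm_Cauchy_Schwarz:
  "p (rinner x y) \<le> module_seminorm rinner p x * module_seminorm rinner p y"
proof -
  note p = seminormsD[OF pS]
  have "(p (rinner x y))\<^sup>2 = p (rinner y x * rinner x y)"
    using seminorm_star_mult[OF p, of "rinner x y"] rinner_star[of y x] by simp
  also have "\<dots> \<le> p (rinner y y) * p (rinner x x)"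
    by (subst rinner_mult_rinner) (rule seminorm_mult[OF p])
  also have "\<dots> = (module_seminorm rinner p x * module_seminorm rinner p y)\<^sup>2"
    by (simp add: power_mult_distrib module_seminorm_square)
  finally show ?thesis
    by (rule power2_le_imp_le) (simp add: module_seminorm_nonneg)
qed

lemma module_seminorm_triangle:
  "module_seminorm rinner p (x + y) \<le> module_seminorm rinner p x + module_seminorm rinner p y"
proof -
  note p = seminormsD[OF pS]
  have "p (rinner (x + y) (x + y)) \<le> (p (rinner x x) + p (rinner x y)) + (p (rinner y x) + p (rinner y y))"
    unfolding rinner_add rinner_add_left
    by (smt (verit) seminorm_add[OF p])
  then have "(module_seminorm rinner p (x + y))\<^sup>2
      \<le> (module_seminorm rinner p x + module_seminorm rinner p y)\<^sup>2"
    using module_seminorm_Cauchy_Schwarz[of x y] module_seminorm_Cauchy_Schwarz[of y x]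
    unfolding power2_sum module_seminorm_square by (simp add: algebra_simps)
  then show ?thesis by (rule power2_le_imp_le) (simp add: module_seminorm_nonneg)
qed

lemma module_seminorm_scale:
  "module_seminorm rinner p (scaleE c x) = cmod c * module_seminorm rinner p x"
proof -
  have "p (rinner (scaleE c x) (scaleE c x)) = (cmod c)\<^sup>2 * p (rinner x x)"
    by (simp add: rinner_scale rinner_scale_left seminorm_scale[OF seminormsD[OF pS]]
        power2_eq_square norm_mult)
  then show ?thesis unfolding module_seminorm_def by (simp add: real_sqrt_mult)
qed

end

subsection \<open>Adjointable maps\<close>

abbreviation adjointables where
  "adjointables \<equiv> adjointable_maps scaleA star scaleE ract rinner"

lemma adjointablesI:
  assumes adj: "\<And>x y. rinner (T x) y = rinner x (T' y)"
    and bounded: "\<And>p. p \<in> seminorms \<Longrightarrow>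
      \<exists>C. \<forall>x. module_seminorm rinner p (T x) \<le> C * module_seminorm rinner p x"
  shows "T \<in> adjointables"
  unfolding adjointable_maps_def
proof (intro CollectI conjI allI ballI bounded)
  show "T (x + y) = T x + T y" for x y
    by (rule eq_if_rinner_eq) (simp add: adj rinner_add_left)
  show "T (scaleE c x) = scaleE c (T x)" for c x
    by (rule eq_if_rinner_eq) (simp add: adj rinner_scale_left)
  show "T (ract x a) = ract (T x) a" for x a
    by (rule eq_if_rinner_eq) (simp add: adj rinner_ract_left)
  show "\<exists>T'. \<forall>x y. rinner (T x) y = rinner x (T' y)" using adj by blast
qed

lemma adjointables_add: "T \<in> adjointables \<Longrightarrow> T (x + y) = T x + T y"
  and adjointables_ract: "T \<in> adjointables \<Longrightarrow> T (ract x a) = ract (T x) a"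
  and adjointables_adjoint: "T \<in> adjointables \<Longrightarrow> \<exists>T'. \<forall>x y. rinner (T x) y = rinner x (T' y)"
  unfolding adjointable_maps_def by blast+

lemma adjointables_zero: "T \<in> adjointables \<Longrightarrow> T 0 = 0"
  using adjointables_add[of T 0 0] by simp

lemma adjointables_comp:
  assumes S: "S \<in> adjointables" and T: "T \<in> adjointables"
  shows "S \<circ> T \<in> adjointables"
proof -
  obtain S' T' where adj: "\<And>x y. rinner (S x) y = rinner x (S' y)"
      "\<And>x y. rinner (T x) y = rinner x (T' y)"
    using adjointables_adjoint[OF S] adjointables_adjoint[OF T] by blast
  show ?thesis
  proof (rule adjointablesI)
    show "rinner ((S \<circ> T) x) y = rinner x ((T' \<circ> S') y)" for x y by (simp add: adj)
    fix p assume pS: "p \<in> seminorms"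
    obtain C where C: "\<And>x. module_seminorm rinner p (S x) \<le> C * module_seminorm rinner p x"
      using S pS unfolding adjointable_maps_def by blast
    obtain C' where C': "\<And>x. module_seminorm rinner p (T x) \<le> C' * module_seminorm rinner p x"
      using T pS unfolding adjointable_maps_def by blast
    have "module_seminorm rinner p ((S \<circ> T) x) \<le> (\<bar>C\<bar> * C') * module_seminorm rinner p x" for x
    proof -
      have "module_seminorm rinner p (S (T x)) \<le> C * module_seminorm rinner p (T x)" by (rule C)
      also have "\<dots> \<le> \<bar>C\<bar> * module_seminorm rinner p (T x)"
        by (intro mult_right_mono module_seminorm_nonneg[OF pS]) simp
      also have "\<dots> \<le> \<bar>C\<bar> * (C' * module_seminorm rinner p x)"
        by (intro mult_left_mono C') simp
      finally show ?thesis by (simp add: mult.assoc)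
    qed
    then show "\<exists>C. \<forall>x. module_seminorm rinner p ((S \<circ> T) x) \<le> C * module_seminorm rinner p x"
      by blast
  qed
qed

lemma affine_lact_adjointable: "(\<lambda>x. scaleE c x + lact b x) \<in> adjointables"
proof (rule adjointablesI)
  show "rinner (scaleE c x + lact b x) y = rinner x (scaleE (cnj c) y + lact (star b) y)" for x y
    by (simp add: rinner_add_left rinner_add rinner_scale_left rinner_scale lact_adjoint)
  fix p assume pS: "p \<in> seminorms"
  have "module_seminorm rinner p (scaleE c x + lact b x) \<le> (cmod c + p b) * module_seminorm rinner p x" for x
    using module_seminorm_triangle[OF pS, of "scaleE c x" "lact b x"] lact_bounded[OF pS, of b x]
    by (simp add: module_seminorm_scale[OF pS] distrib_right)
  then show "\<exists>C. \<forall>x. module_seminorm rinner p (scaleE c x + lact b x) \<le> C * module_seminorm rinner p x"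
    by blast
qed

lemma lact_adjointable: "lact b \<in> adjointables"
  using affine_lact_adjointable[of 0 b] by simp

lemma lact_zero: "lact 0 x = 0"
  using lact_add_left[of 0 0 x] by simp

lemma scale_adjointable: "scaleE c \<in> adjointables"
  using affine_lact_adjointable[of c 0] by (simp add: lact_zero)

lemma id_adjointable: "id \<in> adjointables"
proof -
  have "scaleE 1 = id" by (simp add: fun_eq_iff)
  then show ?thesis using scale_adjointable[of 1] by (simp only:)
qed

lemma adjointables_ract_rinner:
  assumes "S \<in> adjointables"
  shows "ract (S x) (rinner y z) = ract x (rinner y (S z))"
proof -
  obtain S' where S': "\<And>x y. rinner (S x) y = rinner x (S' y)"
    using adjointables_adjoint[OF assms] by blast
  have adj: "rinner y (S x) = rinner (S' y) x" for x y
    by (metis S' rinner_star)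
  have "ract (S x) (rinner y z) = ract z (rinner (S' y) x)"
    by (metis adj ract_rinner_swap)
  also have "\<dots> = ract x (rinner y (S z))"
    by (metis adj ract_rinner_swap)
  finally show ?thesis .
qed

lemma eq_if_ract_rinner_eq:
  assumes "\<And>y z. ract u (rinner y z) = ract v (rinner y z)"
  shows "u = v"
proof -
  have "u - v = 0"
    by (rule ract_rinner_self_zero) (simp add: ract_diff_left assms)
  then show ?thesis by simp
qed

text \<open>
The algebra of adjointable maps is commutative.
\<close>

lemma adjointables_commute:
  assumes S: "S \<in> adjointables" and T: "T \<in> adjointables"
  shows "S (T x) = T (S x)"
proof (rule eq_if_ract_rinner_eq)
  fix y z
  have "ract (S (T x)) (rinner y z) = ract (T x) (rinner y (S z))"
    by (rule adjointables_ract_rinner[OF S])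
  also have "\<dots> = T (ract (S x) (rinner y z))"
    by (simp add: adjointables_ract[OF T] adjointables_ract_rinner[OF S])
  finally show "ract (S (T x)) (rinner y z) = ract (T (S x)) (rinner y z)"
    by (simp add: adjointables_ract[OF T])
qed

section \<open>Derivations\<close>

context
  fixes D
  assumes D: "derivation_on adjointables (\<lambda>S T x. S x + T x) (\<lambda>c T x. scaleE c (T x)) (\<circ>) D"
begin

lemma derivation_closed: "T \<in> adjointables \<Longrightarrow> D T \<in> adjointables"
  and derivation_add: "S \<in> adjointables \<Longrightarrow> T \<in> adjointables \<Longrightarrow>
    D (\<lambda>x. S x + T x) = (\<lambda>x. D S x + D T x)"
  and derivation_scale: "T \<in> adjointables \<Longrightarrow> D (\<lambda>x. scaleE c (T x)) = (\<lambda>x. scaleE c (D T x))"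
  and derivation_comp: "S \<in> adjointables \<Longrightarrow> T \<in> adjointables \<Longrightarrow>
    D (S \<circ> T) = (\<lambda>x. D S (T x) + S (D T x))"
  using D unfolding derivation_on_def by (auto simp: Pi_iff)

lemma derivation_scalar: "D (scaleE c) = (\<lambda>x. 0)"
proof -
  have "D id = (\<lambda>x. D id x + D id x)"
    using derivation_comp[OF id_adjointable id_adjointable] by simp
  then have "D id x = 0" for x
    by (metis add_cancel_right_right)
  then show ?thesis
    using derivation_scale[OF id_adjointable, of c] by (simp add: E.scale_zero_right)
qed

lemma derivation_cube:
  assumes W: "W \<in> adjointables"
  shows "D (W \<circ> (W \<circ> W)) x = W (W (D W x + D W x + D W x))"
proof -
  have "D W (W y) = W (D W y)" for y
    by (rule adjointables_commute[OF derivation_closed[OF W] W])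
  then show ?thesis
    by (simp add: derivation_comp W adjointables_comp adjointables_add add.assoc)
qed

text \<open>
For each real \<open>s\<close> the map \<open>a - s\<close> is the cube of \<open>W = root 3 (a - s)\<close>, whence \<open>D(a) = 3 W\<^sup>2 D(W)\<close> is divisible by a
function of \<open>a\<close> that vanishes at \<open>s\<close>.
\<close>

lemma derivation_lact_self_adjoint:
  assumes sa: "star a = a"
  shows "D (lact a) z = 0"
proof -
  have "linner (D (lact a) z) y = 0" for y
  proof (rule eq_zero_if_locally_divisible[OF sa])
    fix s :: real
    define g where "g = (\<lambda>t. root 3 (t - s))"
    have g: "continuous_on UNIV g" unfolding g_def by (intro continuous_intros)
    \<comment> \<open>\<open>W\<close> is \<open>g(a)\<close> acting on the module; the scalar part \<open>g(0)\<close> is split off as the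
      algebra need not have a unit.\<close>
    define W where "W = (\<lambda>x. scaleE (of_real (g 0)) x + lact (fcalc_elt a g) x)"
    have W: "W \<in> adjointables" unfolding W_def by (rule affine_lact_adjointable)
    have linner_W: "linner (W x) y = fcalc a g (linner x y)" for x y
      unfolding W_def fcalc_def[OF sa] by (simp add: linner_add linner_scale linner_lact)
    have "W \<circ> (W \<circ> W) = (\<lambda>x. lact a x + scaleE (- of_real s) x)"
    proof (rule ext, rule eq_if_linner_eq)
      fix x y
      have cube: "(\<lambda>t. g t * (g t * g t)) = poly [:-s, 1:]"
      proof
        fix t
        have "g t * (g t * g t) = root 3 (t - s) ^ 3"
          unfolding g_def by (simp add: power3_eq_cube)
        also have "\<dots> = t - s" by (rule odd_real_root_pow) simp
        finally show "g t * (g t * g t) = poly [:-s, 1:] t" by simp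
      qed
      have "linner ((W \<circ> (W \<circ> W)) x) y = fcalc a g (fcalc a g (fcalc a g (linner x y)))"
        by (simp add: linner_W)
      also have "\<dots> = fcalc a g (fcalc a (\<lambda>t. g t * g t) (linner x y))"
        by (simp only: fcalc_mult[OF sa g g])
      also have "\<dots> = fcalc a (\<lambda>t. g t * (g t * g t)) (linner x y)"
        by (rule fcalc_mult[OF sa g continuous_on_mult[OF g g], symmetric])
      also have "\<dots> = poly_act a [:-s, 1:] (linner x y)"
        unfolding cube by (rule fcalc_poly[OF sa])
      also have "\<dots> = linner (lact a x + scaleE (- of_real s) x) y"
        by (simp add: linner_add linner_diff_left linner_scale linner_lact)
      finally show "linner ((W \<circ> (W \<circ> W)) x) y = linner (lact a x + scaleE (- of_real s) x) y" .
    qed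
    then have "D (lact a) z = D (W \<circ> (W \<circ> W)) z"
      by (simp only: derivation_add lact_adjointable scale_adjointable derivation_scalar add_0_right)
    also have "\<dots> = W (W (D W z + D W z + D W z))"
      by (rule derivation_cube[OF W])
    finally have "linner (D (lact a) z) y
        = fcalc a g (fcalc a g (linner (D W z + D W z + D W z) y))"
      by (simp add: linner_W)
    also have "\<dots> = fcalc a (\<lambda>t. g t * g t) (linner (D W z + D W z + D W z) y)"
      by (rule fcalc_mult[OF sa g g, symmetric])
    finally show "\<exists>w k. continuous_on UNIV w \<and> w s = 0 \<and> linner (D (lact a) z) y = fcalc a w k"
      using g by (intro exI[of _ "\<lambda>t. g t * g t"] exI conjI) (auto intro: continuous_on_mult simp: g_def)
  qed
  then show ?thesis by (simp flip: linner_eq_0)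
qed

lemma derivation_lact: "D (lact b) z = 0"
proof -
  define a1 a2 where "a1 = (1/2) *\<^sub>A (b + star b)" and "a2 = (- \<i> / 2) *\<^sub>A (b - star b)"
  have sa: "star a1 = a1" "star a2 = a2"
    unfolding a1_def a2_def
    by (simp_all add: star_scale star_add star_diff star_star add.commute scale_right_diff_distrib)
  have "b = a1 + \<i> *\<^sub>A a2"
    unfolding a1_def a2_def
    using scale_left_distrib[of "1/2" "1/2" b]
    by (simp add: scale_right_distrib scale_right_diff_distrib)
  then have "lact b = (\<lambda>x. lact a1 x + scaleE \<i> (lact a2 x))"
    by (simp add: fun_eq_iff lact_add_left lact_scale_left)
  moreover have "(\<lambda>x. scaleE \<i> (lact a2 x)) \<in> adjointables"
  proof -
    have "(\<lambda>x. scaleE \<i> (lact a2 x)) = lact (\<i> *\<^sub>A a2)"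
      by (simp add: fun_eq_iff lact_scale_left)
    then show ?thesis by (simp only: lact_adjointable)
  qed
  ultimately show ?thesis
    by (simp add: derivation_add derivation_scale lact_adjointable
        derivation_lact_self_adjoint sa E.scale_zero_right)
qed

text \<open>
For \<open>\<theta> = linner u v\<close> both \<open>\<theta>\<close> and \<open>T \<circ> \<theta>\<close> are left multiplications, on which \<open>D\<close> vanishes; hence
\<open>D(T) \<circ> \<theta> = 0\<close>, and the ranges of the maps \<open>\<theta>\<close> determine an adjointable map.
\<close>

lemma derivation_eq_zero:
  assumes T: "T \<in> adjointables"
  shows "D T = (\<lambda>x. 0)"
proof
  fix u
  show "D T u = 0"
  proof (rule eq_if_ract_rinner_eq)
    fix v w
    have "T \<circ> lact (linner u v) = lact (linner (T u) v)"
      by (simp add: fun_eq_iff inner_compatible adjointables_ract[OF T])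
    then have "0 = D (T \<circ> lact (linner u v)) w"
      by (simp add: derivation_lact)
    also have "\<dots> = D T (ract u (rinner v w))"
      by (simp add: derivation_comp T lact_adjointable derivation_lact adjointables_zero inner_compatible)
    finally show "ract (D T u) (rinner v w) = ract 0 (rinner v w)"
      by (simp add: adjointables_ract[OF derivation_closed[OF T]] ract_zero_left)
  qed
qed

end

end

theorem theorem3p6:
  fixes scaleA :: "complex \<Rightarrow> 'a \<Rightarrow>
      'a::{ring, t2_space, uniform_topological_group_add, topological_semigroup_mult}"
    and star :: "'a \<Rightarrow> 'a"
    and scaleE :: "complex \<Rightarrow> 'e::ab_group_add \<Rightarrow> 'e"
    and lact :: "'a \<Rightarrow> 'e \<Rightarrow> 'e"
    and linner :: "'e \<Rightarrow> 'e \<Rightarrow> 'a"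
    and ract :: "'e \<Rightarrow> 'a \<Rightarrow> 'e"
    and rinner :: "'e \<Rightarrow> 'e \<Rightarrow> 'a"
    and D :: "('e \<Rightarrow> 'e) \<Rightarrow> ('e \<Rightarrow> 'e)"
  assumes "sigma_C_star_algebra scaleA star"
    and "\<forall>a b :: 'a. a * b = b * a"
    and "Hilbert_bimodule scaleA star scaleE lact linner ract rinner"
    and "derivation_on (adjointable_maps scaleA star scaleE ract rinner)
           (\<lambda>S T x. S x + T x) (\<lambda>c T x. scaleE c (T x)) (\<circ>) D"
  shows "\<forall>T \<in> adjointable_maps scaleA star scaleE ract rinner. D T = (\<lambda>x. 0)"
proof -
  interpret bimodule: Hilbert_bimodule scaleA star scaleE lact linner ract rinner
    by fact
  interpret commutative_Hilbert_bimodule scaleA star scaleE lact linner ract rinner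
    by unfold_locales (use assms(2) in blast)
  show ?thesis using derivation_eq_zero[OF assms(4)] by blast
qed

end
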